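(* Consider a solution $(p,q,r,\gamma_1,\gamma_2,\gamma_3)(t)$ of the Kovalevskaya system $$2\dot p - qr = 0,\quad 2\dot q + rp = \gamma_3,\quad \dot r = -\gamma_2,\quad \dot\gamma_1 = r\gamma_2 - q\gamma_3,\quad \dot\gamma_2 = p\gamma_3 - r\gamma_1,\quad \dot\gamma_3 = q\gamma_1 - p\gamma_2,$$ with $\gamma_1^2+\gamma_2^2+\gamma_3^2=1$ and zero area integral $2(p\gamma_1+q\gamma_2)+r\gamma_3=0$. Let $h = p^2+q^2+\tfrac12 r^2+\gamma_1$ and $k^2=(p^2-q^2-\gamma_1)^2+(2pq-\gamma_2)^2$ be the values of the other two first integrals on this solution. Suppose that $(k^2,h)$ belongs to one of the two open regions $$\{(k^2,h): h>0,\ 0<k^2<h^2,\ k^2<1\}\quad\text{or}\quad \{(k^2,h): h>0,\ 1<k^2<h^2\},$$ and that the two-dimensional invariant torus containing the solution is non-resonant. Then the mean motion of the line of nodes is zero: the precession angle $\psi$ along the solution has mean motion $\Lambda=0$.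
   Context: Here $(p,q,r,\gamma_1,\gamma_2,\gamma_3)\in\mathbb{R}^6$. The four first integrals are $p^2+q^2+\tfrac12r^2+\gamma_1=h$, $2(p\gamma_1+q\gamma_2)+r\gamma_3=c$ (the area integral), $\gamma_1^2+\gamma_2^2+\gamma_3^2=1$, and $(p^2-q^2-\gamma_1)^2+(2pq-\gamma_2)^2=k^2$. For $c=0$ and $(k^2,h)$ in either of the two regions these integrals are functionally independent on their common level set, and this level set consists of two two-dimensional tori, each invariant under the flow. On each torus there are angle coordinates $\varphi_1,\varphi_2$ (mod $2\pi$) in which the flow is $\dot\varphi_i=\omega_i$ with constants $\omega_1,\omega_2$; the torus is called non-resonant if $\omega_1,\omega_2$ are linearly independent over $\mathbb{Q}$. Precession angle (angle of the line of nodes): the real-valued function $\psi(t)$ along the solution defined, up to its initial value, by $$\dot\psi=\frac{p\gamma_1+q\gamma_2}{\gamma_1^2+\gamma_2^2}.$$ For $c=0$ and $(k^2,h)$ in these regions solutions never pass through points with $\gamma_3=\pm1$, so the right-hand side is well defined. Mean motion: a function $\psi(t)$ has mean motion $\Lambda\in\mathbb{R}$ if $\psi(t)=\psi(0)+\Lambda t+O(1)$ for all $t$, i.e. $\psi(t)-\Lambda t$ is bounded. *)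

theory Defs
  imports "HOL-Analysis.Analysis"
begin

text \<open>Phase points are tuples \<open>(p, q, r, \<gamma>\<^sub>1, \<gamma>\<^sub>2, \<gamma>\<^sub>3)\<close>.\<close>

type_synonym phase = "real \<times> real \<times> real \<times> real \<times> real \<times> real"

fun energy :: "phase \<Rightarrow> real" where
  "energy (p, q, r, g1, g2, g3) = p\<^sup>2 + q\<^sup>2 + r\<^sup>2 / 2 + g1"

fun area_integral :: "phase \<Rightarrow> real" where
  "area_integral (p, q, r, g1, g2, g3) = 2 * (p * g1 + q * g2) + r * g3"

fun geometric_integral :: "phase \<Rightarrow> real" where
  "geometric_integral (p, q, r, g1, g2, g3) = g1\<^sup>2 + g2\<^sup>2 + g3\<^sup>2"

fun kovalevskaya_integral :: "phase \<Rightarrow> real" where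
  "kovalevskaya_integral (p, q, r, g1, g2, g3) = (p\<^sup>2 - q\<^sup>2 - g1)\<^sup>2 + (2 * p * q - g2)\<^sup>2"

definition level_set :: "real \<Rightarrow> real \<Rightarrow> real \<Rightarrow> phase set" where
  "level_set h c k = {x. energy x = h \<and> area_integral x = c \<and>
     geometric_integral x = 1 \<and> kovalevskaya_integral x = k\<^sup>2}"

text \<open>The system \<open>2p' - qr = 0\<close>, \<open>2q' + rp = \<gamma>\<^sub>3\<close>, \<open>r' = -\<gamma>\<^sub>2\<close>, \<open>\<gamma>\<^sub>1' = r\<gamma>\<^sub>2 - q\<gamma>\<^sub>3\<close>,
  \<open>\<gamma>\<^sub>2' = p\<gamma>\<^sub>3 - r\<gamma>\<^sub>1\<close>, \<open>\<gamma>\<^sub>3' = q\<gamma>\<^sub>1 - p\<gamma>\<^sub>2\<close>, solved for the derivatives.\<close>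

fun kovalevskaya_field :: "phase \<Rightarrow> phase" where
  "kovalevskaya_field (p, q, r, g1, g2, g3) =
     (q * r / 2, (g3 - r * p) / 2, - g2, r * g2 - q * g3, p * g3 - r * g1, q * g1 - p * g2)"

definition kovalevskaya_solution :: "(real \<Rightarrow> phase) \<Rightarrow> bool" where
  "kovalevskaya_solution x \<longleftrightarrow>
     (\<forall>t. (x has_vector_derivative kovalevskaya_field (x t)) (at t))"

text \<open>Angle coordinates \<open>(\<phi>\<^sub>1, \<phi>\<^sub>2)\<close> mod \<open>2\<pi>\<close> on \<open>T\<close> are represented by their inverse \<open>\<Phi>\<close>, lifted
  to the universal cover: a doubly \<open>2\<pi>\<close>-periodic \<open>C\<^sup>1\<close> immersion of the plane onto \<open>T\<close>, injective
  modulo the periods. Since the quotient of the plane by the periods is compact, this says exactly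
  that \<open>T\<close> is an embedded two-dimensional torus and that \<open>\<Phi>\<close> induces a \<open>C\<^sup>1\<close> diffeomorphism
  onto it.\<close>

definition angle_coordinates :: "phase set \<Rightarrow> (real \<times> real \<Rightarrow> phase) \<Rightarrow> bool" where
  "angle_coordinates T \<Phi> \<longleftrightarrow>
     range \<Phi> = T \<and>
     (\<forall>a b a' b'. \<Phi> (a, b) = \<Phi> (a', b') \<longleftrightarrow>
        (\<exists>m n :: int. a' = a + 2 * pi * of_int m \<and> b' = b + 2 * pi * of_int n)) \<and>
     (\<exists>D :: real \<times> real \<Rightarrow> (real \<times> real) \<Rightarrow>\<^sub>L phase.
        continuous_on UNIV D \<and>
        (\<forall>u. (\<Phi> has_derivative blinfun_apply (D u)) (at u) \<and> inj (blinfun_apply (D u))))"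

text \<open>The flow reads \<open>\<phi>\<^sub>i' = \<omega>\<^sub>i\<close> in the angle coordinates given by \<open>\<Phi>\<close>.\<close>

definition linear_flow :: "(real \<times> real \<Rightarrow> phase) \<Rightarrow> real \<Rightarrow> real \<Rightarrow> bool" where
  "linear_flow \<Phi> \<omega>1 \<omega>2 \<longleftrightarrow>
     (\<forall>a b. kovalevskaya_solution (\<lambda>t. \<Phi> (a + \<omega>1 * t, b + \<omega>2 * t)))"

definition rationally_independent :: "real \<Rightarrow> real \<Rightarrow> bool" where
  "rationally_independent \<omega>1 \<omega>2 \<longleftrightarrow>
     (\<forall>a b :: rat. of_rat a * \<omega>1 + of_rat b * \<omega>2 = 0 \<longrightarrow> a = 0 \<and> b = 0)"

text \<open>Changing the angle coordinates of a torus acts on the frequency vector by an element of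
  \<open>GL(2, \<int>)\<close>, so the existential quantifier does not depend on the choice made.\<close>

definition nonresonant_torus :: "phase set \<Rightarrow> bool" where
  "nonresonant_torus T \<longleftrightarrow>
     (\<exists>\<Phi> \<omega>1 \<omega>2. angle_coordinates T \<Phi> \<and> linear_flow \<Phi> \<omega>1 \<omega>2 \<and> rationally_independent \<omega>1 \<omega>2)"

fun precession_rate :: "phase \<Rightarrow> real" where
  "precession_rate (p, q, r, g1, g2, g3) = (p * g1 + q * g2) / (g1\<^sup>2 + g2\<^sup>2)"

definition precession_angle :: "(real \<Rightarrow> phase) \<Rightarrow> (real \<Rightarrow> real) \<Rightarrow> bool" where
  "precession_angle x \<psi> \<longleftrightarrow>
     (\<forall>t. (\<psi> has_real_derivative precession_rate (x t)) (at t))"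

text \<open>The denominator of the precession rate does not vanish when \<open>c = 0\<close> and \<open>k\<^sup>2 < h\<^sup>2\<close>.\<close>

lemma precession_rate_denominator:
  assumes "(p, q, r, g1, g2, g3) \<in> level_set h 0 k" and "k\<^sup>2 < h\<^sup>2"
  shows "g1\<^sup>2 + g2\<^sup>2 \<noteq> 0"
proof
  assume "g1\<^sup>2 + g2\<^sup>2 = 0"
  then have g: "g1 = 0" "g2 = 0"
    by (simp_all add: sum_power2_eq_zero_iff)
  with assms(1) have "g3\<^sup>2 = 1" "r * g3 = 0"
    by (simp_all add: level_set_def)
  then have "r = 0"
    by auto
  with g assms(1) have "h = p\<^sup>2 + q\<^sup>2" "k\<^sup>2 = (p\<^sup>2 - q\<^sup>2)\<^sup>2 + (2 * p * q)\<^sup>2"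
    by (simp_all add: level_set_def)
  then have "k\<^sup>2 = h\<^sup>2"
    by (simp add: power2_eq_square algebra_simps)
  with assms(2) show False
    by simp
qed

definition has_mean_motion :: "(real \<Rightarrow> real) \<Rightarrow> real \<Rightarrow> bool" where
  "has_mean_motion \<psi> \<Lambda> \<longleftrightarrow> bounded (range (\<lambda>t. \<psi> t - \<Lambda> * t))"

end

theory Submission imports Defs begin

text \<open>Let \<open>X\<close> be the Kovalevskaya field, \<open>Y\<close> the commuting Hamiltonian field of the Kovalevskaya
  integral, and \<open>F\<close>, \<open>G\<close> the rates of the precession angle along them, so that \<open>X(G) = Y(F)\<close>.
  In the angle coordinates of a non-resonant torus both fields are constant, and they are linearly
  independent. Under displacement of an orbit segment along \<open>Y\<close>, the integral of \<open>F\<close> over it changes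
  at the rate \<open>G(end) - G(start)\<close>. Since any two points of the torus are joined by bounded times along
  \<open>X\<close> and \<open>Y\<close>, the integral of \<open>F\<close> over an orbit segment of given length depends on its initial point
  only up to a bounded error. The map \<open>(p, q, r, \<gamma>\<^sub>1, \<gamma>\<^sub>2, \<gamma>\<^sub>3) \<mapsto> (-p, q, r, \<gamma>\<^sub>1, -\<gamma>\<^sub>2, -\<gamma>\<^sub>3)\<close>
  reverses time and changes the sign of \<open>F\<close>. It has a fixed point on every torus: where \<open>q\<^sup>2\<close> is
  maximal, \<open>X(q) = Y(q) = 0\<close>, which forces \<open>p = \<gamma>\<^sub>2 = \<gamma>\<^sub>3 = 0\<close>. On the orbit of such a point the integral
  of \<open>F\<close> over \<open>[-t, 0]\<close> is minus the integral over \<open>[0, t]\<close>, and equal to it up to a bounded error,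
  so both are bounded.\<close>

section \<open>The commuting field of the Kovalevskaya integral\<close>

text \<open>In the angular momenta \<open>(2p, 2q, r)\<close> and \<open>\<gamma>\<close> the system is Hamiltonian for the Lie-Poisson
  bracket of \<open>e(3)\<close>, with the energy as Hamiltonian. The next field is the Hamiltonian field of the
  Kovalevskaya integral, and \<open>commuting_rate\<close> the rate of the precession angle along it.\<close>

fun commuting_field :: "phase \<Rightarrow> phase" where
  "commuting_field (p, q, r, g1, g2, g3) =
    (let A = p\<^sup>2 - q\<^sup>2 - g1; B = 2 * p * q - g2;
         n1 = 2 * (p * A + q * B); n2 = 2 * (p * B - q * A)
     in (g3 * B - r * n2 / 2, r * n1 / 2 - A * g3, 2 * (g1 * B - g2 * A),
         - (g3 * n2), g3 * n1, g1 * n2 - g2 * n1))"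

fun commuting_rate :: "phase \<Rightarrow> real" where
  "commuting_rate (p, q, r, g1, g2, g3) =
    (let A = p\<^sup>2 - q\<^sup>2 - g1; B = 2 * p * q - g2
     in (2 * (p * A + q * B) * g1 + 2 * (p * B - q * A) * g2) / (g1\<^sup>2 + g2\<^sup>2))"

section \<open>Differentials of the integrals, the field and the precession rate\<close>

fun energy_diff :: "phase \<Rightarrow> phase \<Rightarrow> real" where
  "energy_diff (p, q, r, g1, g2, g3) (p', q', r', g1', g2', g3') =
     2 * p * p' + 2 * q * q' + r * r' + g1'"

fun area_diff :: "phase \<Rightarrow> phase \<Rightarrow> real" where
  "area_diff (p, q, r, g1, g2, g3) (p', q', r', g1', g2', g3') =
     2 * (p' * g1 + p * g1' + q' * g2 + q * g2') + r' * g3 + r * g3'"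

fun geometric_diff :: "phase \<Rightarrow> phase \<Rightarrow> real" where
  "geometric_diff (p, q, r, g1, g2, g3) (p', q', r', g1', g2', g3') =
     2 * (g1 * g1' + g2 * g2' + g3 * g3')"

fun kovalevskaya_diff :: "phase \<Rightarrow> phase \<Rightarrow> real" where
  "kovalevskaya_diff (p, q, r, g1, g2, g3) (p', q', r', g1', g2', g3') =
     2 * (p\<^sup>2 - q\<^sup>2 - g1) * (2 * p * p' - 2 * q * q' - g1') +
     2 * (2 * p * q - g2) * (2 * p' * q + 2 * p * q' - g2')"

fun field_diff :: "phase \<Rightarrow> phase \<Rightarrow> phase" where
  "field_diff (p, q, r, g1, g2, g3) (p', q', r', g1', g2', g3') =
     ((q' * r + q * r') / 2, (g3' - r' * p - r * p') / 2, - g2',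
      r' * g2 + r * g2' - q' * g3 - q * g3', p' * g3 + p * g3' - r' * g1 - r * g1',
      q' * g1 + q * g1' - p' * g2 - p * g2')"

fun precession_diff :: "phase \<Rightarrow> phase \<Rightarrow> real" where
  "precession_diff (p, q, r, g1, g2, g3) (p', q', r', g1', g2', g3') =
     ((p' * g1 + p * g1' + q' * g2 + q * g2') * (g1\<^sup>2 + g2\<^sup>2)
       - (p * g1 + q * g2) * (2 * g1 * g1' + 2 * g2 * g2')) / (g1\<^sup>2 + g2\<^sup>2)\<^sup>2"

lemma has_vector_derivative_components:
  assumes "((\<lambda>t. (p t, q t, r t, g1 t, g2 t, g3 t)) has_vector_derivative
             (p', q', r', g1', g2', g3' :: real)) (at s)"
  shows "(p has_real_derivative p') (at s)" "(q has_real_derivative q') (at s)"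
    "(r has_real_derivative r') (at s)" "(g1 has_real_derivative g1') (at s)"
    "(g2 has_real_derivative g2') (at s)" "(g3 has_real_derivative g3') (at s)"
proof -
  note f = bounded_linear.has_vector_derivative[OF bounded_linear_fst]
  note d = bounded_linear.has_vector_derivative[OF bounded_linear_snd]
  note 1 = d[OF assms]
  note 2 = d[OF 1]
  note 3 = d[OF 2]
  note 4 = d[OF 3]
  show "(p has_real_derivative p') (at s)" "(q has_real_derivative q') (at s)"
    "(r has_real_derivative r') (at s)" "(g1 has_real_derivative g1') (at s)"
    "(g2 has_real_derivative g2') (at s)" "(g3 has_real_derivative g3') (at s)"
    using f[OF assms] f[OF 1] f[OF 2] f[OF 3] f[OF 4] d[OF 4]
    by (simp_all add: has_real_derivative_iff_has_vector_derivative)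
qed

lemma curve_components:
  fixes y :: "real \<Rightarrow> phase"
  obtains p q r g1 g2 g3 where "\<And>t. y t = (p t, q t, r t, g1 t, g2 t, g3 t)"
  by (rule that[of "\<lambda>t. fst (y t)" "\<lambda>t. fst (snd (y t))" "\<lambda>t. fst (snd (snd (y t)))"
     "\<lambda>t. fst (snd (snd (snd (y t))))" "\<lambda>t. fst (snd (snd (snd (snd (y t)))))"
     "\<lambda>t. snd (snd (snd (snd (snd (y t)))))"]) simp

lemma first_integrals_chain:
  assumes "(y has_vector_derivative v) (at s)"
  shows "((\<lambda>t. energy (y t)) has_real_derivative energy_diff (y s) v) (at s)"
    "((\<lambda>t. area_integral (y t)) has_real_derivative area_diff (y s) v) (at s)"
    "((\<lambda>t. geometric_integral (y t)) has_real_derivative geometric_diff (y s) v) (at s)"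
    "((\<lambda>t. kovalevskaya_integral (y t)) has_real_derivative kovalevskaya_diff (y s) v) (at s)"
proof -
  obtain p q r g1 g2 g3 where y: "\<And>t. y t = (p t, q t, r t, g1 t, g2 t, g3 t)"
    by (rule curve_components[of y]) blast
  obtain p' q' r' g1' g2' g3' where v: "v = (p', q', r', g1', g2', g3')"
    by (metis prod.exhaust)
  note [derivative_intros] = has_vector_derivative_components[OF assms[unfolded v y]]
  show "((\<lambda>t. energy (y t)) has_real_derivative energy_diff (y s) v) (at s)"
    "((\<lambda>t. area_integral (y t)) has_real_derivative area_diff (y s) v) (at s)"
    "((\<lambda>t. geometric_integral (y t)) has_real_derivative geometric_diff (y s) v) (at s)"
    "((\<lambda>t. kovalevskaya_integral (y t)) has_real_derivative kovalevskaya_diff (y s) v) (at s)"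
    unfolding y v energy.simps area_integral.simps geometric_integral.simps
      kovalevskaya_integral.simps energy_diff.simps area_diff.simps geometric_diff.simps
      kovalevskaya_diff.simps
    by (rule derivative_eq_intros refl | simp add: algebra_simps)+
qed

text \<open>The field is Hamiltonian with the Kovalevskaya integral as Hamiltonian: this integral is
  in involution with the energy, and the other two integrals are Casimir functions. Hence the field
  is tangent to the level sets.\<close>

lemma first_integrals_commuting_field:
  "energy_diff x (commuting_field x) = 0" "area_diff x (commuting_field x) = 0"
  "geometric_diff x (commuting_field x) = 0" "kovalevskaya_diff x (commuting_field x) = 0"
proof -
  obtain p q r g1 g2 g3 where x: "x = (p, q, r, g1, g2, g3)"
    by (metis prod.exhaust)
  show "energy_diff x (commuting_field x) = 0" "area_diff x (commuting_field x) = 0"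
    "geometric_diff x (commuting_field x) = 0" "kovalevskaya_diff x (commuting_field x) = 0"
    unfolding x by (simp_all add: Let_def field_simps power2_eq_square)
qed

text \<open>For a quadratic map the derivative at the midpoint gives the difference exactly. The
  difference of two solutions therefore solves a linear equation, to which a Gronwall argument
  applies.\<close>

lemma field_difference:
  "kovalevskaya_field x - kovalevskaya_field y = field_diff ((1/2) *\<^sub>R (x + y)) (x - y)"
  by (cases x; cases y) (simp add: field_simps)

lemma field_chain:
  assumes "(y has_vector_derivative v) (at s)"
  shows "((\<lambda>t. kovalevskaya_field (y t)) has_vector_derivative field_diff (y s) v) (at s)"
proof -
  obtain p q r g1 g2 g3 where y: "\<And>t. y t = (p t, q t, r t, g1 t, g2 t, g3 t)"
    by (rule curve_components[of y]) blast
  obtain p' q' r' g1' g2' g3' where v: "v = (p', q', r', g1', g2', g3')"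
    by (metis prod.exhaust)
  note [derivative_intros] = has_vector_derivative_components[OF assms[unfolded v y]]
  show ?thesis
    unfolding y v kovalevskaya_field.simps field_diff.simps
    apply (intro has_vector_derivative_Pair
        has_real_derivative_iff_has_vector_derivative[THEN iffD1])
    by (rule derivative_eq_intros refl | simp add: field_simps)+
qed

text \<open>Vanishing of the Lie bracket of the two fields.\<close>

lemma commuting_field_variational:
  assumes "(y has_vector_derivative kovalevskaya_field (y s)) (at s)"
  shows "((\<lambda>t. commuting_field (y t)) has_vector_derivative
           field_diff (y s) (commuting_field (y s))) (at s)"
proof -
  obtain p q r g1 g2 g3 where y: "\<And>t. y t = (p t, q t, r t, g1 t, g2 t, g3 t)"
    by (rule curve_components[of y]) blast
  note [derivative_intros] =
    has_vector_derivative_components[OF assms[unfolded y kovalevskaya_field.simps]]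
  show ?thesis
    unfolding y commuting_field.simps field_diff.simps Let_def
    apply (intro has_vector_derivative_Pair
        has_real_derivative_iff_has_vector_derivative[THEN iffD1])
    by (rule derivative_eq_intros refl | simp add: field_simps power2_eq_square)+
qed

lemma precession_rate_chain:
  assumes "(y has_vector_derivative v) (at s)"
    and "y s \<in> level_set h 0 k" "k\<^sup>2 < h\<^sup>2"
  shows "((\<lambda>t. precession_rate (y t)) has_real_derivative precession_diff (y s) v) (at s)"
proof -
  obtain p q r g1 g2 g3 where y: "\<And>t. y t = (p t, q t, r t, g1 t, g2 t, g3 t)"
    by (rule curve_components[of y]) blast
  obtain p' q' r' g1' g2' g3' where v: "v = (p', q', r', g1', g2', g3')"
    by (metis prod.exhaust)
  have d: "(g1 s)\<^sup>2 + (g2 s)\<^sup>2 \<noteq> 0"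
    using precession_rate_denominator[OF assms(2)[unfolded y] assms(3)] .
  note [derivative_intros] = has_vector_derivative_components[OF assms(1)[unfolded v y]]
  show ?thesis
    unfolding y v precession_rate.simps precession_diff.simps
    by (rule derivative_eq_intros d refl)+
      (simp add: power2_eq_square algebra_simps add_divide_distrib diff_divide_distrib)
qed

text \<open>The bracket still vanishes after lifting the two fields to the phase space with the precession
  angle adjoined: together with \<open>precession_rate_chain\<close> this is \<open>X(G) = Y(F)\<close> for the rates \<open>F\<close>, \<open>G\<close>
  of the angle along the fields \<open>X\<close>, \<open>Y\<close>.\<close>

lemma commuting_rate_along_field:
  assumes "(y has_vector_derivative kovalevskaya_field (y s)) (at s)"
    and "y s \<in> level_set h 0 k" "k\<^sup>2 < h\<^sup>2"
  shows "((\<lambda>t. commuting_rate (y t)) has_real_derivative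
           precession_diff (y s) (commuting_field (y s))) (at s)"
proof -
  obtain p q r g1 g2 g3 where y: "\<And>t. y t = (p t, q t, r t, g1 t, g2 t, g3 t)"
    by (rule curve_components[of y]) blast
  have d: "(g1 s)\<^sup>2 + (g2 s)\<^sup>2 \<noteq> 0"
    using precession_rate_denominator[OF assms(2)[unfolded y] assms(3)] .
  note [derivative_intros] =
    has_vector_derivative_components[OF assms(1)[unfolded y kovalevskaya_field.simps]]
  show ?thesis
    unfolding y commuting_rate.simps precession_diff.simps commuting_field.simps Let_def
    by (rule derivative_eq_intros d refl)+
      (simp add: power2_eq_square algebra_simps add_divide_distrib diff_divide_distrib)
qed

section \<open>Continuity of the fields and rates\<close>

abbreviation coordinates :: "phase \<Rightarrow> phase" where
  "coordinates x \<equiv> (fst x, fst (snd x), fst (snd (snd x)), fst (snd (snd (snd x))),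
     fst (snd (snd (snd (snd x)))), snd (snd (snd (snd (snd x)))))"

lemma continuous_kovalevskaya_field: "continuous_on S kovalevskaya_field"
proof -
  \<comment> \<open>The function is defined by matching on tuples. Rebuilding its argument from
    projections lets the defining equation unfold into an expression in continuous
    coordinates.\<close>
  have "continuous_on S (\<lambda>x. kovalevskaya_field (coordinates x))"
    unfolding kovalevskaya_field.simps
    by (intro continuous_intros ballI) simp_all
  then show ?thesis by simp
qed

lemma continuous_commuting_field: "continuous_on S commuting_field"
proof -
  have "continuous_on S (\<lambda>x. commuting_field (coordinates x))"
    unfolding commuting_field.simps Let_def
    by (intro continuous_intros ballI) simp_all
  then show ?thesis by simp
qed

lemma continuous_field_diff:
  assumes "continuous_on S f" "continuous_on S g"
  shows "continuous_on S (\<lambda>x. field_diff (f x) (g x))"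
proof -
  have "continuous_on S (\<lambda>x. field_diff (coordinates (f x)) (coordinates (g x)))"
    unfolding field_diff.simps
    by (intro continuous_intros ballI assms) simp_all
  then show ?thesis by simp
qed

lemma level_set_denominator:
  assumes "x \<in> level_set h 0 k" and "k\<^sup>2 < h\<^sup>2"
  shows "(fst (snd (snd (snd x))))\<^sup>2 + (fst (snd (snd (snd (snd x)))))\<^sup>2 \<noteq> 0"
  using precession_rate_denominator[of "fst x" "fst (snd x)" "fst (snd (snd x))"
    "fst (snd (snd (snd x)))" "fst (snd (snd (snd (snd x))))" "snd (snd (snd (snd (snd x))))"] assms
  unfolding prod.collapse by blast

lemma continuous_precession_rate:
  assumes "k\<^sup>2 < h\<^sup>2"
  shows "continuous_on (level_set h 0 k) precession_rate"
proof -
  have "continuous_on (level_set h 0 k) (\<lambda>x. precession_rate (coordinates x))"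
    unfolding precession_rate.simps
    by (intro continuous_intros ballI level_set_denominator[OF _ assms])
  then show ?thesis by simp
qed

lemma continuous_commuting_rate:
  assumes "k\<^sup>2 < h\<^sup>2"
  shows "continuous_on (level_set h 0 k) commuting_rate"
proof -
  have "continuous_on (level_set h 0 k) (\<lambda>x. commuting_rate (coordinates x))"
    unfolding commuting_rate.simps Let_def
    by (intro continuous_intros ballI level_set_denominator[OF _ assms])
  then show ?thesis by simp
qed

lemma continuous_precession_diff:
  assumes "k\<^sup>2 < h\<^sup>2" and "continuous_on (level_set h 0 k) V"
  shows "continuous_on (level_set h 0 k) (\<lambda>x. precession_diff x (V x))"
proof -
  have "continuous_on (level_set h 0 k) (\<lambda>x. precession_diff (coordinates x) (coordinates (V x)))"
    unfolding precession_diff.simps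
    by (intro continuous_intros assms(2) ballI power_not_zero level_set_denominator[OF _ assms(1)])
  then show ?thesis by simp
qed

lemma field_diff_linear: "linear (field_diff x)"
proof -
  obtain p q r g1 g2 g3 where x: "x = (p, q, r, g1, g2, g3)"
    by (metis prod.exhaust)
  show ?thesis
    unfolding x by (rule linearI) (auto simp: algebra_simps add_divide_distrib diff_divide_distrib)
qed

section \<open>Non-degeneracy of the level sets\<close>

lemma level_set_iff:
  "(p, q, r, g1, g2, g3) \<in> level_set h 0 k \<longleftrightarrow>
     p\<^sup>2 + q\<^sup>2 + r\<^sup>2 / 2 + g1 = h \<and> 2 * (p * g1 + q * g2) + r * g3 = 0 \<and>
     g1\<^sup>2 + g2\<^sup>2 + g3\<^sup>2 = 1 \<and> (p\<^sup>2 - q\<^sup>2 - g1)\<^sup>2 + (2 * p * q - g2)\<^sup>2 = k\<^sup>2"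
  by (simp add: level_set_def)

text \<open>The area integral makes (p, q) orthogonal to the unit vector (g1, g2), so it is a
  multiple \<open>m\<close> of its quarter turn. Then
  \<open>h\<^sup>2 - k\<^sup>2 = g1\<^sup>2 - 1\<close>, which cannot be positive.\<close>

lemma level_set_not_equatorial:
  assumes "(p, q, r, g1, g2, g3) \<in> level_set h 0 k" and "k\<^sup>2 < h\<^sup>2"
    and "r = 0" "g3 = 0"
  shows False
proof -
  have e: "h = p\<^sup>2 + q\<^sup>2 + g1" "p * g1 + q * g2 = 0" "g1\<^sup>2 + g2\<^sup>2 = 1"
    "k\<^sup>2 = (p\<^sup>2 - q\<^sup>2 - g1)\<^sup>2 + (2 * p * q - g2)\<^sup>2"
    using assms by (auto simp: level_set_iff)
  define m where "m = q * g1 - p * g2"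
  have p: "p = - m * g2" and q: "q = m * g1"
    unfolding m_def using e by algebra+
  have "h\<^sup>2 - k\<^sup>2 = g1\<^sup>2 - 1"
    using e(3) unfolding e(1) e(4) p q by algebra
  with assms(2) have "g1\<^sup>2 > 1" by linarith
  moreover have "g2\<^sup>2 \<ge> 0" by simp
  ultimately show False using e(3) by linarith
qed

text \<open>The last two hypotheses say that q and its derivative along the flow vanish. If p = 0,
  then g3 = 0 and \<open>k\<^sup>2\<close> is the squared length of \<gamma>, which is 1. Otherwise
  the area integral gives \<open>g1 = - r\<^sup>2 / 2\<close>, so that \<open>h = p\<^sup>2\<close>
  and \<open>h\<^sup>2 - k\<^sup>2 = -1\<close>.\<close>

lemma level_set_q_nonconstant:
  assumes "(p, q, r, g1, g2, g3) \<in> level_set h 0 k" and "k\<^sup>2 < h\<^sup>2" "k\<^sup>2 \<noteq> 1"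
    and "q = 0" "g3 = r * p"
  shows False
proof -
  have e: "h = p\<^sup>2 + r\<^sup>2 / 2 + g1" "p * (2 * g1 + r\<^sup>2) = 0" "g1\<^sup>2 + g2\<^sup>2 + (r * p)\<^sup>2 = 1"
    "k\<^sup>2 = (p\<^sup>2 - g1)\<^sup>2 + g2\<^sup>2"
    using assms by (auto simp: level_set_iff algebra_simps power2_eq_square)
  show False
  proof (cases "p = 0")
    case True
    with e assms show False by simp
  next
    case False
    then have "g1 = - r\<^sup>2 / 2" using e by simp
    then have "h\<^sup>2 - k\<^sup>2 = -1"
      using e(3) unfolding e(1,4) by (simp add: power2_eq_square algebra_simps)
    with assms(2) show False by linarith
  qed
qed

lemma level_set_q_critical:
  assumes "(p, q, r, g1, g2, g3) \<in> level_set h 0 k" and "k\<^sup>2 < h\<^sup>2" "k\<^sup>2 \<noteq> 1" "h > 0"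
    and "fst (snd (kovalevskaya_field (p, q, r, g1, g2, g3))) = 0"
    and "fst (snd (commuting_field (p, q, r, g1, g2, g3))) = 0"
  shows "p = 0 \<and> g2 = 0 \<and> g3 = 0"
proof -
  have g3: "g3 = r * p" using assms(5) by simp
  \<comment> \<open>After substituting g3 = r p, the terms with the factor p A cancel in the second
    component of the commuting field.\<close>
  have "r * q * (2 * p * q - g2) = 0"
    using assms(6) unfolding g3 by (simp add: Let_def field_simps power2_eq_square)
  moreover have "q \<noteq> 0" using level_set_q_nonconstant[OF assms(1-3) _ g3] by blast
  moreover have "r \<noteq> 0"
    using level_set_not_equatorial[OF assms(1-2)] g3 by auto
  ultimately have g2: "g2 = 2 * p * q" by simp
  have e: "h = p\<^sup>2 + q\<^sup>2 + r\<^sup>2 / 2 + g1" "p * (2 * g1 + 4 * q\<^sup>2 + r\<^sup>2) = 0"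
    "k\<^sup>2 = (p\<^sup>2 - q\<^sup>2 - g1)\<^sup>2"
    using assms(1) g2 g3 by (auto simp: level_set_iff algebra_simps power2_eq_square)
  have "p = 0"
  proof (rule ccontr)
    assume "p \<noteq> 0"
    \<comment> \<open>Eliminating r from the energy gives \<open>h = p\<^sup>2 - q\<^sup>2\<close>,
      hence \<open>k\<^sup>2 = (h - g1)\<^sup>2\<close>. With \<open>k\<^sup>2 < h\<^sup>2\<close>
      and h > 0 this forces g1 > 0, against the sign given by this equation.\<close>
    then have g1: "2 * g1 + 4 * q\<^sup>2 + r\<^sup>2 = 0" using e by simp
    then have h: "h = p\<^sup>2 - q\<^sup>2" using e by linarith
    have "(h - g1)\<^sup>2 < h\<^sup>2" using assms(2) unfolding e(3) h .
    then have "\<bar>h - g1\<bar> < \<bar>h\<bar>" using abs_le_square_iff linorder_not_le by blast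
    then have "g1 > 0" using assms(4) by linarith
    moreover have "q\<^sup>2 \<ge> 0" "r\<^sup>2 \<ge> 0" by auto
    ultimately show False using g1 by linarith
  qed
  with g2 g3 show ?thesis by simp
qed

lemma level_set_field_nonzero:
  assumes "x \<in> level_set h 0 k" and "k\<^sup>2 < h\<^sup>2" "k\<^sup>2 \<noteq> 1"
  shows "kovalevskaya_field x \<noteq> 0"
proof
  assume 0: "kovalevskaya_field x = 0"
  obtain p q r g1 g2 g3 where x: "x = (p, q, r, g1, g2, g3)"
    by (metis prod.exhaust)
  have e: "g3 = r * p" "g2 = 0" "q * g1 = p * g2"
    using 0 unfolding x by (auto simp: zero_prod_def)
  have "g1 \<noteq> 0"
    using precession_rate_denominator[OF assms(1)[unfolded x] assms(2)] e by auto
  then have "q = 0" using e by simp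
  then show False using level_set_q_nonconstant[OF assms(1)[unfolded x] assms(2,3)] e by simp
qed

text \<open>With \<open>z = p + iq\<close>, \<open>\<zeta> = \<gamma>\<^sub>1 + i\<gamma>\<^sub>2\<close>, \<open>w = z\<^sup>2 - \<zeta>\<close>, \<open>v = rz - \<gamma>\<^sub>3\<close> with \<open>v'\<close> the
  conjugate of \<open>v\<close>, a linear relation between the fields gives \<open>a v = 2 w v'\<close>, hence \<open>a\<^sup>2 = 4k\<^sup>2\<close> unless
  \<open>v = 0\<close>, and \<open>\<nu> \<zeta> |v|\<^sup>2 = 2 a R v\<close>, \<open>\<nu> \<gamma>\<^sub>3 = a r\<close> with \<open>R = Re (z v')\<close>. Multiplying the area
  integral by \<open>\<nu> |v|\<^sup>2\<close> turns it into \<open>4 a R\<^sup>2 + a r\<^sup>2 |v|\<^sup>2 = 0\<close>.\<close>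

lemma level_set_fields_independent_aux:
  assumes L: "x \<in> level_set h 0 k" and k: "k\<^sup>2 < h\<^sup>2" "k\<^sup>2 \<noteq> 1" "k\<^sup>2 \<noteq> 0"
    and rel: "a *\<^sub>R kovalevskaya_field x + commuting_field x = 0"
  shows False
proof -
  obtain p q r g1 g2 g3 where x: "x = (p, q, r, g1, g2, g3)"
    by (metis prod.exhaust)
  define A B where "A = p\<^sup>2 - q\<^sup>2 - g1" and "B = 2 * p * q - g2"
  define n1 n2 where "n1 = 2 * (p * A + q * B)" and "n2 = 2 * (p * B - q * A)"
  define v1 v2 where "v1 = r * p - g3" and "v2 = r * q"
  define \<nu> where "\<nu> = g1 * (a * p + n1) + g2 * (a * q + n2) + g3 * (a * r)"
  define R where "R = p * v1 + q * v2"
  have e: "h = p\<^sup>2 + q\<^sup>2 + r\<^sup>2 / 2 + g1" "2 * (p * g1 + q * g2) + r * g3 = 0"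
    "g1\<^sup>2 + g2\<^sup>2 + g3\<^sup>2 = 1" "A\<^sup>2 + B\<^sup>2 = k\<^sup>2"
    using L unfolding x level_set_iff A_def B_def by auto
  have "a * (q * r / 2) + (g3 * B - r * n2 / 2) = 0"
    "a * ((g3 - r * p) / 2) + (r * n1 / 2 - A * g3) = 0"
    "a * (r * g2 - q * g3) - g3 * n2 = 0" "a * (p * g3 - r * g1) + g3 * n1 = 0"
    "a * (q * g1 - p * g2) + g1 * n2 - g2 * n1 = 0"
    using rel unfolding x by (simp_all add: Let_def zero_prod_def A_def B_def n1_def n2_def)
  then have f: "a * v2 = 2 * (v1 * B - v2 * A)" "a * v1 = 2 * (v1 * A + v2 * B)"
    and g: "g3 * (a * q + n2) = g2 * (a * r)" "g3 * (a * p + n1) = g1 * (a * r)"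
      "g1 * (a * q + n2) = g2 * (a * p + n1)"
    unfolding v1_def v2_def n1_def n2_def by (simp_all add: field_simps)
  \<comment> \<open>The relations \<open>g\<close> say that (a p + n1, a q + n2, a r) is parallel to
    \<gamma>. As \<gamma> is a unit vector, the factor is their inner product
    \<open>\<nu>\<close>.\<close>
  have \<nu>: "\<nu> * g1 = a * p + n1" "\<nu> * g2 = a * q + n2" "\<nu> * g3 = a * r"
    unfolding \<nu>_def using g e(3) by algebra+
  have v: "v1\<^sup>2 + v2\<^sup>2 \<noteq> 0"
  proof
    assume "v1\<^sup>2 + v2\<^sup>2 = 0"
    then have v0: "g3 = r * p" "r * q = 0"
      by (simp_all add: sum_power2_eq_zero_iff v1_def v2_def)
    then show False
      using level_set_q_nonconstant[OF L[unfolded x] k(1,2)]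
        level_set_not_equatorial[OF L[unfolded x] k(1)] by auto
  qed
  have "a\<^sup>2 * (v1\<^sup>2 + v2\<^sup>2) = 4 * (A\<^sup>2 + B\<^sup>2) * (v1\<^sup>2 + v2\<^sup>2)"
    using f by algebra
  then have a: "a \<noteq> 0" using v k(3) e(4) by auto
  have z: "\<nu> * g1 * (v1\<^sup>2 + v2\<^sup>2) = 2 * a * R * v1" "\<nu> * g2 * (v1\<^sup>2 + v2\<^sup>2) = 2 * a * R * v2"
    unfolding \<nu> R_def n1_def n2_def using f by algebra+
  have "a * (4 * R\<^sup>2 + r\<^sup>2 * (v1\<^sup>2 + v2\<^sup>2)) =
      \<nu> * (v1\<^sup>2 + v2\<^sup>2) * (2 * (p * g1 + q * g2) + r * g3)"
    using z \<nu>(3) unfolding R_def by algebra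
  then have "4 * R\<^sup>2 + r\<^sup>2 * (v1\<^sup>2 + v2\<^sup>2) = 0" using e(2) a by simp
  then have "(2 * R)\<^sup>2 + (r * v1)\<^sup>2 + (r * v2)\<^sup>2 = 0" by (simp add: algebra_simps
      power_mult_distrib)
  moreover have "(r * v1)\<^sup>2 \<ge> 0" "(r * v2)\<^sup>2 \<ge> 0" "(2 * R)\<^sup>2 \<ge> 0" by simp_all
  ultimately have "(2 * R)\<^sup>2 = 0" "(r * v1)\<^sup>2 = 0" "(r * v2)\<^sup>2 = 0" by linarith+
  \<comment> \<open>What remains is the case R = r = 0 with g3 nonzero. There p and B vanish and h =
    -A, so \<open>k\<^sup>2 = h\<^sup>2\<close>.\<close>
  then have "R = 0" and r: "r = 0" using v by auto
  have g3: "g3 \<noteq> 0" using level_set_not_equatorial[OF L[unfolded x] k(1)] r by auto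
  then have p: "p = 0" using \<open>R = 0\<close> r by (simp add: R_def v1_def v2_def)
  have "B = 0" using f(1) g3 r by (simp add: v1_def v2_def)
  then have "h = - A" "k\<^sup>2 = A\<^sup>2" using e p r by (simp_all add: A_def)
  then show False using k(1) by simp
qed

lemma level_set_fields_independent:
  assumes "x \<in> level_set h 0 k" and "k\<^sup>2 < h\<^sup>2" "k\<^sup>2 \<noteq> 1" "k\<^sup>2 \<noteq> 0"
    and rel: "a *\<^sub>R kovalevskaya_field x + b *\<^sub>R commuting_field x = 0"
  shows "a = 0 \<and> b = 0"
proof (cases "b = 0")
  case True
  then show ?thesis using level_set_field_nonzero[OF assms(1-3)] rel by simp
next
  case False
  have "(a / b) *\<^sub>R kovalevskaya_field x + commuting_field x =
      (1 / b) *\<^sub>R (a *\<^sub>R kovalevskaya_field x + b *\<^sub>R commuting_field x)"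
    using False by (simp add: scaleR_add_right)
  then have "(a / b) *\<^sub>R kovalevskaya_field x + commuting_field x = 0" using rel by simp
  then show ?thesis using level_set_fields_independent_aux[OF assms(1-4)] by blast
qed

text \<open>The Lie-Poisson structure of \<open>e(3)\<close>, applied to a covector in the coordinates
  \<open>(p, q, r, \<gamma>)\<close>. The area integral and \<open>|\<gamma>|\<^sup>2\<close> are Casimir functions.\<close>

fun lie_poisson :: "phase \<Rightarrow> phase \<Rightarrow> phase" where
  "lie_poisson (p, q, r, g1, g2, g3) (d1, d2, d3, d4, d5, d6) =
     ((2 * q * d3 - r * d2 / 2 + g2 * d6 - g3 * d5) / 2,
      (r * d1 / 2 - 2 * p * d3 + g3 * d4 - g1 * d6) / 2,
      p * d2 - q * d1 + g1 * d5 - g2 * d4,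
      g2 * d3 - g3 * d2 / 2, g3 * d1 / 2 - g1 * d3, (g1 * d2 - g2 * d1) / 2)"

text \<open>Combinations of the gradients of the energy, area, geometric and Kovalevskaya integrals,
  in this order. As a linear map in the coefficients, its injectivity is the independence of the
  four integrals.\<close>

fun integral_covector :: "phase \<Rightarrow> real \<times> real \<times> real \<times> real \<Rightarrow> phase" where
  "integral_covector (p, q, r, g1, g2, g3) (a, b, c, d) =
     a *\<^sub>R (2 * p, 2 * q, r, 1, 0, 0) + b *\<^sub>R (2 * g1, 2 * g2, g3, 2 * p, 2 * q, r) +
     c *\<^sub>R (0, 0, 0, 2 * g1, 2 * g2, 2 * g3) +
     d *\<^sub>R (4 * p * (p\<^sup>2 - q\<^sup>2 - g1) + 4 * q * (2 * p * q - g2),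
           4 * p * (2 * p * q - g2) - 4 * q * (p\<^sup>2 - q\<^sup>2 - g1), 0,
           - 2 * (p\<^sup>2 - q\<^sup>2 - g1), - 2 * (2 * p * q - g2), 0)"

lemma inner_integral_covector:
  "integral_covector x (a, b, c, d) \<bullet> v = a * energy_diff x v + b * area_diff x v +
     c * geometric_diff x v + d * kovalevskaya_diff x v"
proof -
  obtain p q r g1 g2 g3 where x: "x = (p, q, r, g1, g2, g3)"
    by (metis prod.exhaust)
  obtain p' q' r' g1' g2' g3' where v: "v = (p', q', r', g1', g2', g3')"
    by (metis prod.exhaust)
  show ?thesis unfolding x v by (simp add: algebra_simps)
qed

text \<open>The coefficients b and c belong to Casimir functions and drop out, so a relation between
  gradients becomes one between the two fields.\<close>

lemma lie_poisson_integral_covector: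
  "lie_poisson x (integral_covector x (a, b, c, d)) =
     a *\<^sub>R kovalevskaya_field x + d *\<^sub>R commuting_field x"
proof -
  obtain p q r g1 g2 g3 where x: "x = (p, q, r, g1, g2, g3)"
    by (metis prod.exhaust)
  show ?thesis unfolding x by (simp add: Let_def field_simps power2_eq_square)
qed

lemma linear_integral_covector: "linear (integral_covector x)"
proof -
  obtain p q r g1 g2 g3 where x: "x = (p, q, r, g1, g2, g3)"
    by (metis prod.exhaust)
  show ?thesis unfolding x by (rule linearI) (auto simp: algebra_simps)
qed

text \<open>Applying the Poisson structure leaves a relation between the fields, whose independence
  gives a = d = 0. The gradients of the two Casimir functions are independent because (g1, g2) is
  nonzero.\<close>

lemma integral_covector_eq_0:
  assumes L: "x \<in> level_set h 0 k" and "k\<^sup>2 < h\<^sup>2" "k\<^sup>2 \<noteq> 1" "k\<^sup>2 \<noteq> 0"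
    and 0: "integral_covector x u = 0"
  shows "u = 0"
proof -
  obtain p q r g1 g2 g3 where x: "x = (p, q, r, g1, g2, g3)"
    by (metis prod.exhaust)
  obtain a b c d where u: "u = (a, b, c, d)"
    by (metis prod.exhaust)
  have "lie_poisson x 0 = 0"
    unfolding x by (simp add: zero_prod_def)
  with 0 have "a *\<^sub>R kovalevskaya_field x + d *\<^sub>R commuting_field x = 0"
    unfolding u lie_poisson_integral_covector[of x a b c d, symmetric] by simp
  then have ad: "a = 0" "d = 0"
    using level_set_fields_independent[OF assms(1-4)] by blast+
  have "g1\<^sup>2 + g2\<^sup>2 \<noteq> 0"
    using precession_rate_denominator L assms(2) unfolding x by blast
  then have g: "g1 \<noteq> 0 \<or> g2 \<noteq> 0" by auto
  have "b * g1 = 0" "b * g2 = 0"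
    and c: "b * p + c * g1 = 0" "b * q + c * g2 = 0"
    using 0 unfolding u x ad by (simp_all add: zero_prod_def algebra_simps)
  then have "b = 0" using g by auto
  then have "c = 0" using g c by auto
  with \<open>b = 0\<close> ad show ?thesis by (simp add: u zero_prod_def)
qed

section \<open>Tangent planes of the level sets\<close>

definition tangent_plane :: "phase \<Rightarrow> phase set" where
  "tangent_plane x = {v. energy_diff x v = 0 \<and> area_diff x v = 0 \<and>
     geometric_diff x v = 0 \<and> kovalevskaya_diff x v = 0}"

lemma tangent_plane_orthogonal:
  "tangent_plane x = {v \<in> UNIV. \<forall>n \<in> range (integral_covector x). orthogonal n v}"
proof -
  have "v \<in> tangent_plane x \<longleftrightarrow> (\<forall>u. integral_covector x u \<bullet> v = 0)" for v
  proof
    assume "v \<in> tangent_plane x"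
    then show "\<forall>u. integral_covector x u \<bullet> v = 0"
      by (auto simp: tangent_plane_def inner_integral_covector)
  next
    assume *: "\<forall>u. integral_covector x u \<bullet> v = 0"
    show "v \<in> tangent_plane x"
      using *[rule_format, of "(1, 0, 0, 0)"] *[rule_format, of "(0, 1, 0, 0)"]
        *[rule_format, of "(0, 0, 1, 0)"] *[rule_format, of "(0, 0, 0, 1)"]
      by (simp add: tangent_plane_def inner_integral_covector)
  qed
  then show ?thesis by (auto simp: orthogonal_def)
qed

lemma subspace_tangent_plane: "subspace (tangent_plane x)"
  unfolding tangent_plane_orthogonal
  by (auto simp: subspace_def orthogonal_def inner_add_right)

lemma dim_tangent_plane:
  assumes "x \<in> level_set h 0 k" and "k\<^sup>2 < h\<^sup>2" "k\<^sup>2 \<noteq> 1" "k\<^sup>2 \<noteq> 0"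
  shows "dim (tangent_plane x) = 2"
proof -
  have "inj (integral_covector x)"
    using linear_injective_0[OF linear_integral_covector] integral_covector_eq_0[OF assms] by blast
  then have "dim (range (integral_covector x)) = 4"
    using dim_image_eq[OF linear_integral_covector, of x UNIV] by (simp add: dim_UNIV)
  moreover have "dim (tangent_plane x) + dim (range (integral_covector x)) =
      dim (UNIV :: phase set)"
    unfolding tangent_plane_orthogonal
    by (rule dim_subspace_orthogonal_to_vectors)
      (auto intro: linear_subspace_image linear_integral_covector)
  ultimately show ?thesis by (simp add: dim_UNIV)
qed

text \<open>Since \<gamma> has length 1, g1 is at least -1, and the energy then bounds p, q and
  r.\<close>

lemma bounded_level_set: "bounded (level_set h 0 k)"
proof (rule boundedI)
  fix x assume L: "x \<in> level_set h 0 k"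
  obtain p q r g1 g2 g3 where x: "x = (p, q, r, g1, g2, g3)"
    by (metis prod.exhaust)
  have e: "p\<^sup>2 + q\<^sup>2 + r\<^sup>2 / 2 + g1 = h" "g1\<^sup>2 + g2\<^sup>2 + g3\<^sup>2 = 1"
    using L unfolding x level_set_iff by auto
  have "g1\<^sup>2 \<le> 1" using e(2) zero_le_power2[of g2] zero_le_power2[of g3] by linarith
  then have "- 1 \<le> g1" by (simp add: abs_square_le_1 abs_le_iff)
  moreover have "(norm x)\<^sup>2 = p\<^sup>2 + q\<^sup>2 + r\<^sup>2 + (g1\<^sup>2 + g2\<^sup>2 + g3\<^sup>2)"
    unfolding x power2_norm_eq_inner by (simp add: power2_eq_square)
  ultimately have "(norm x)\<^sup>2 \<le> 2 * h + 3"
    using e zero_le_power2[of p] zero_le_power2[of q] by linarith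
  then show "norm x \<le> sqrt (2 * h + 3)" by (rule real_le_rsqrt)
qed

section \<open>Solutions and their variations\<close>

text \<open>The squared norm of \<open>d\<close> times exp(-2 C s) is nonincreasing for s \<ge> 0,
  and times exp(2 C s) nondecreasing for s \<le> 0. Either way it is at most its value 0 at s =
  0.\<close>

lemma gronwall_zero:
  fixes d :: "real \<Rightarrow> 'a::real_inner"
  assumes d: "\<And>t. (d has_vector_derivative d' t) (at t)"
    and b: "\<And>t. norm (d' t) \<le> C * norm (d t)" and 0: "d 0 = 0"
  shows "d t = 0"
proof -
  have deriv: "((\<lambda>s. exp (c * s) * (d s \<bullet> d s)) has_real_derivative
      exp (c * s) * (c * (d s \<bullet> d s) + 2 * (d s \<bullet> d' s))) (at s)" for c s
  proof -
    have "((\<lambda>s. d s \<bullet> d s) has_real_derivative 2 * (d s \<bullet> d' s)) (at s)"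
      using bounded_bilinear.has_vector_derivative[OF bounded_bilinear_inner d d]
      by (simp add: has_real_derivative_iff_has_vector_derivative inner_commute)
    note [derivative_intros] = this
    show ?thesis by (rule derivative_eq_intros refl | simp add: algebra_simps)+
  qed
  have bd: "\<bar>d s \<bullet> d' s\<bar> \<le> C * (d s \<bullet> d s)" for s
  proof -
    have "\<bar>d s \<bullet> d' s\<bar> \<le> norm (d s) * norm (d' s)" by (rule Cauchy_Schwarz_ineq2)
    also have "\<dots> \<le> norm (d s) * (C * norm (d s))" by (intro mult_left_mono b) simp
    finally show ?thesis by (simp add: dot_square_norm power2_eq_square mult_ac)
  qed
  have "exp (c * t) * (d t \<bullet> d t) \<le> 0" if "c = (if t \<ge> 0 then - 2 * C else 2 * C)" for c
  proof (cases "t \<ge> 0")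
    case True
    have "exp (c * t) * (d t \<bullet> d t) \<le> exp (c * 0) * (d 0 \<bullet> d 0)"
    proof (rule DERIV_nonpos_imp_nonincreasing[where a = 0 and b = t
          and f = "\<lambda>s. exp (c * s) * (d s \<bullet> d s)"])
      fix s
      have "c * (d s \<bullet> d s) + 2 * (d s \<bullet> d' s) \<le> 0" using bd[of s] True that by auto
      then show "\<exists>y. ((\<lambda>s. exp (c * s) * (d s \<bullet> d s)) has_real_derivative y) (at s) \<and> y \<le> 0"
        using deriv[of c s]
        by (intro exI[of _ "exp (c * s) * (c * (d s \<bullet> d s) + 2 * (d s \<bullet> d' s))"])
          (simp add: mult_le_0_iff)
    qed (use True in simp)
    then show ?thesis using 0 by simp
  next
    case False
    have "exp (c * t) * (d t \<bullet> d t) \<le> exp (c * 0) * (d 0 \<bullet> d 0)"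
    proof (rule DERIV_nonneg_imp_nondecreasing[where a = t and b = 0
          and f = "\<lambda>s. exp (c * s) * (d s \<bullet> d s)"])
      fix s
      have "c * (d s \<bullet> d s) + 2 * (d s \<bullet> d' s) \<ge> 0" using bd[of s] False that by auto
      then show "\<exists>y. ((\<lambda>s. exp (c * s) * (d s \<bullet> d s)) has_real_derivative y) (at s) \<and> y \<ge> 0"
        using deriv[of c s]
        by (intro exI[of _ "exp (c * s) * (c * (d s \<bullet> d s) + 2 * (d s \<bullet> d' s))"]) simp
    qed (use False in simp)
    then show ?thesis using 0 by simp
  qed
  then have "d t \<bullet> d t \<le> 0" by (auto simp: mult_le_0_iff)
  then show ?thesis by (metis inner_ge_zero inner_eq_zero_iff order_antisym)
qed

text \<open>Compactness gives a bound on unit vectors over the closure of \<open>S\<close>, and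
  linearity in v extends it. It supplies the constant for \<open>gronwall_zero\<close>.\<close>

lemma field_diff_bound:
  assumes "bounded S"
  obtains C where "\<And>x v. x \<in> S \<Longrightarrow> norm (field_diff x v) \<le> C * norm v"
proof -
  have "compact (closure S \<times> cball (0::phase) 1)"
    using assms by (intro compact_Times) (simp_all add: compact_closure)
  moreover have "continuous_on (closure S \<times> cball (0::phase) 1) (\<lambda>z. field_diff (fst z) (snd z))"
    by (intro continuous_field_diff continuous_intros)
  ultimately have "bounded ((\<lambda>z. field_diff (fst z) (snd z)) ` (closure S \<times> cball 0 1))"
    by (intro compact_imp_bounded compact_continuous_image)
  then obtain C where C: "\<And>z. z \<in> closure S \<times> cball 0 1 \<Longrightarrow> norm (field_diff (fst z) (snd z)) \<le> C"
    unfolding bounded_iff by blast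
  have "norm (field_diff x v) \<le> C * norm v" if "x \<in> S" for x v
  proof (cases "v = 0")
    case True
    then show ?thesis using linear_0[OF field_diff_linear] by simp
  next
    case False
    have "field_diff x v = norm v *\<^sub>R field_diff x (v /\<^sub>R norm v)"
      using False by (simp flip: linear_scale[OF field_diff_linear])
    moreover have "norm (field_diff x (v /\<^sub>R norm v)) \<le> C"
      using C[of "(x, v /\<^sub>R norm v)"] that False closure_subset by auto
    ultimately show ?thesis by (simp add: mult.commute[of "norm v"] mult_right_mono)
  qed
  then show thesis by (rule that)
qed

lemma kovalevskaya_solution_unique:
  assumes x: "kovalevskaya_solution x" "bounded (range x)"
    and y: "kovalevskaya_solution y" "bounded (range y)" and "x 0 = y 0"
  shows "x t = y t"
proof -
  have "bounded ((\<lambda>z. (1/2) *\<^sub>R (fst z + snd z)) ` (range x \<times> range y))"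
    using x(2) y(2)
    by (intro bounded_Times bounded_linear_image[of _ "\<lambda>z. (1/2) *\<^sub>R (fst z + snd z)"]
        bounded_linear_intros)
  then obtain C where C: "\<And>z v. z \<in> (\<lambda>z. (1/2) *\<^sub>R (fst z + snd z)) ` (range x \<times> range y) \<Longrightarrow>
      norm (field_diff z v) \<le> C * norm v"
    by (rule field_diff_bound) blast
  have "x t - y t = 0"
  proof (rule gronwall_zero)
    show "((\<lambda>t. x t - y t) has_vector_derivative field_diff ((1/2) *\<^sub>R (x t + y t)) (x t - y t))
        (at t)" for t
      using x(1) y(1) unfolding kovalevskaya_solution_def field_difference[symmetric]
      by (intro has_vector_derivative_diff) auto
    show "norm (field_diff ((1/2) *\<^sub>R (x t + y t)) (x t - y t)) \<le> C * norm (x t - y t)" for t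
      by (rule C) (auto intro!: image_eqI[of _ _ "(x t, y t)"])
  qed (use assms in simp)
  then show ?thesis by simp
qed

section \<open>The time-reversing symmetry\<close>

fun reversal :: "phase \<Rightarrow> phase" where
  "reversal (p, q, r, g1, g2, g3) = (- p, q, r, g1, - g2, - g3)"

lemma linear_reversal: "linear reversal"
  by (rule linearI) auto

lemma precession_rate_reversal: "precession_rate (reversal x) = - precession_rate x"
proof -
  obtain p q r g1 g2 g3 where x: "x = (p, q, r, g1, g2, g3)"
    by (metis prod.exhaust)
  have "- p * g1 + q * - g2 = - (p * g1 + q * g2)" by simp
  then show ?thesis
    by (simp only: x reversal.simps precession_rate.simps power2_minus minus_divide_left)
qed

lemma kovalevskaya_field_reversal:
  "kovalevskaya_field (reversal x) = - reversal (kovalevskaya_field x)"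
  by (cases x) (simp add: field_simps)

lemma kovalevskaya_solution_reversal:
  assumes "kovalevskaya_solution x"
  shows "kovalevskaya_solution (\<lambda>t. reversal (x (- t)))"
  unfolding kovalevskaya_solution_def
proof
  fix t
  have "((\<lambda>t. x (- t)) has_vector_derivative (- 1) *\<^sub>R kovalevskaya_field (x (- t))) (at t)"
  proof (rule vector_diff_chain_at[of uminus "-1" t x "kovalevskaya_field (x (- t))",
        unfolded o_def])
    show "(uminus has_vector_derivative - 1) (at t)"
      by (auto simp flip: has_real_derivative_iff_has_vector_derivative
          intro!: derivative_eq_intros)
  qed (use assms in \<open>simp add: kovalevskaya_solution_def\<close>)
  then have "((\<lambda>t. reversal (x (- t))) has_vector_derivative
      reversal ((- 1) *\<^sub>R kovalevskaya_field (x (- t)))) (at t)"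
    using bounded_linear.has_vector_derivative linear_conv_bounded_linear linear_reversal by blast
  then show "((\<lambda>t. reversal (x (- t))) has_vector_derivative
      kovalevskaya_field (reversal (x (- t)))) (at t)"
    using linear_scale[OF linear_reversal, of "-1"] by (simp add: kovalevskaya_field_reversal)
qed

section \<open>The precession rate on an invariant torus\<close>

text \<open>The two regions enter through exclusions. \<open>k\<^sup>2 < h\<^sup>2\<close> keeps
  away from \<gamma>3 = 1 and -1, \<open>k\<^sup>2 \<noteq> 1\<close> excludes that q and its
  derivative vanish together, \<open>k\<^sup>2 \<noteq> 0\<close> serves the independence of the two
  fields, and h > 0 the analysis of the critical points of q.\<close>

locale kovalevskaya_torus =
  fixes h k \<omega>1 \<omega>2 :: real and \<Phi> :: "real \<times> real \<Rightarrow> phase"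
    and D :: "real \<times> real \<Rightarrow> (real \<times> real) \<Rightarrow>\<^sub>L phase"
  assumes h_pos: "h > 0" and k: "k\<^sup>2 < h\<^sup>2" "k\<^sup>2 \<noteq> 1" "k\<^sup>2 \<noteq> 0"
    and in_level_set: "\<Phi> u \<in> level_set h 0 k"
    and periodic: "\<Phi> (a + 2 * pi * of_int m, b + 2 * pi * of_int n) = \<Phi> (a, b)"
    and D_continuous: "continuous_on UNIV D"
    and D: "(\<Phi> has_derivative blinfun_apply (D u)) (at u)"
    and D_inj: "inj (blinfun_apply (D u))"
    and linear_flow: "linear_flow \<Phi> \<omega>1 \<omega>2"
    and independent: "rationally_independent \<omega>1 \<omega>2"
begin

definition \<omega> :: "real \<times> real" where "\<omega> = (\<omega>1, \<omega>2)"

lemma frequency_nonzero: "\<omega>1 \<noteq> 0"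
proof
  assume "\<omega>1 = 0"
  then have "of_rat 1 * \<omega>1 + of_rat 0 * \<omega>2 = 0" by simp
  then show False using independent unfolding rationally_independent_def by (metis zero_neq_one)
qed

lemma frequency_ratio: "\<omega>2 / \<omega>1 \<notin> \<rat>"
proof
  assume "\<omega>2 / \<omega>1 \<in> \<rat>"
  then obtain c where "\<omega>2 / \<omega>1 = of_rat c" by (rule Rats_cases)
  then have "of_rat c * \<omega>1 + of_rat (- 1) * \<omega>2 = 0"
    using frequency_nonzero by (simp add: field_simps of_rat_minus)
  then show False using independent unfolding rationally_independent_def
    by (metis zero_neq_one neg_equal_0_iff_equal)
qed

lemma line:
  "((\<lambda>s. \<Phi> (u + s *\<^sub>R v)) has_vector_derivative D (u + s *\<^sub>R v) v) (at s)"
proof -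
  have "((\<lambda>s. u + s *\<^sub>R v) has_derivative (\<lambda>s. s *\<^sub>R v)) (at s)"
    by (auto intro!: derivative_eq_intros)
  from has_derivative_compose[OF this D] show ?thesis
    by (simp add: has_vector_derivative_def blinfun.scaleR_right)
qed

lemma flow: "kovalevskaya_solution (\<lambda>t. \<Phi> (u + t *\<^sub>R \<omega>))"
  using linear_flow by (cases u) (simp add: linear_flow_def \<omega>_def mult.commute)

lemma D_frequency: "D u \<omega> = kovalevskaya_field (\<Phi> u)"
proof -
  have "((\<lambda>t. \<Phi> (u + t *\<^sub>R \<omega>)) has_vector_derivative kovalevskaya_field (\<Phi> u)) (at 0)"
    using flow[of u, unfolded kovalevskaya_solution_def, rule_format, of 0] by simp
  moreover have "((\<lambda>t. \<Phi> (u + t *\<^sub>R \<omega>)) has_vector_derivative D u \<omega>) (at 0)"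
    using line[of u \<omega> 0] by simp
  ultimately show ?thesis by (rule vector_derivative_unique_at[symmetric])
qed

lemma continuous_\<Phi> [continuous_intros]:
  assumes "continuous_on S f"
  shows "continuous_on S (\<lambda>x. \<Phi> (f x))"
proof -
  have "continuous_on UNIV \<Phi>"
    using D has_derivative_continuous by (intro continuous_at_imp_continuous_on) blast
  from continuous_on_compose2[OF this assms] show ?thesis by simp
qed

lemma continuous_D [continuous_intros]:
  assumes "continuous_on S f"
  shows "continuous_on S (\<lambda>x. D (f x) v)"
  using continuous_on_compose2[OF D_continuous assms] by (intro continuous_intros) auto

text \<open>All translates by v are covered at once, so whole orbits and not only their initial
  points can be moved.\<close>

lemma reduce_mod_periods:
  obtains w where "w \<in> cbox (0, 0) (2 * pi, 2 * pi)" "\<And>v. \<Phi> (u + v) = \<Phi> (w + v)"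
proof -
  obtain a b where u: "u = (a, b)" by fastforce
  have fl: "0 \<le> c + 2 * pi * of_int (- \<lfloor>c / (2 * pi)\<rfloor>)"
    "c + 2 * pi * of_int (- \<lfloor>c / (2 * pi)\<rfloor>) \<le> 2 * pi" for c :: real
  proof -
    have "of_int \<lfloor>c / (2 * pi)\<rfloor> \<le> c / (2 * pi)" "c / (2 * pi) \<le> of_int \<lfloor>c / (2 * pi)\<rfloor> + 1"
      by linarith+
    then have "2 * pi * of_int \<lfloor>c / (2 * pi)\<rfloor> \<le> 2 * pi * (c / (2 * pi))"
      "2 * pi * (c / (2 * pi)) \<le> 2 * pi * (of_int \<lfloor>c / (2 * pi)\<rfloor> + 1)"
      by (intro mult_left_mono; simp)+
    then show "0 \<le> c + 2 * pi * of_int (- \<lfloor>c / (2 * pi)\<rfloor>)"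
      "c + 2 * pi * of_int (- \<lfloor>c / (2 * pi)\<rfloor>) \<le> 2 * pi"
      by (simp_all add: algebra_simps)
  qed
  show thesis
  proof (rule that)
    show "(a + 2 * pi * of_int (- \<lfloor>a / (2 * pi)\<rfloor>), b + 2 * pi * of_int (- \<lfloor>b / (2 * pi)\<rfloor>))
        \<in> cbox (0, 0) (2 * pi, 2 * pi)"
      using fl by (simp add: cbox_Pair_iff)
    fix v :: "real \<times> real"
    obtain c d where v: "v = (c, d)" by fastforce
    show "\<Phi> (u + v) = \<Phi> ((a + 2 * pi * of_int (- \<lfloor>a / (2 * pi)\<rfloor>),
        b + 2 * pi * of_int (- \<lfloor>b / (2 * pi)\<rfloor>)) + v)"
      using periodic[of "a + c" "- \<lfloor>a / (2 * pi)\<rfloor>" "b + d" "- \<lfloor>b / (2 * pi)\<rfloor>"]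
      unfolding u v by (simp add: algebra_simps)
  qed
qed

lemma compact_range: "compact (range \<Phi>)"
proof -
  have "range \<Phi> = \<Phi> ` cbox (0, 0) (2 * pi, 2 * pi)"
  proof
    show "range \<Phi> \<subseteq> \<Phi> ` cbox (0, 0) (2 * pi, 2 * pi)"
    proof
      fix x assume "x \<in> range \<Phi>"
      then obtain u where "x = \<Phi> u" by auto
      moreover obtain w where "w \<in> cbox (0, 0) (2 * pi, 2 * pi)" "\<And>v. \<Phi> (u + v) = \<Phi> (w + v)"
        by (rule reduce_mod_periods[of u]) blast
      ultimately show "x \<in> \<Phi> ` cbox (0, 0) (2 * pi, 2 * pi)" by (metis add.right_neutral imageI)
    qed
  qed auto
  then show ?thesis by (simp add: compact_continuous_image continuous_intros)
qed

text \<open>As \<open>\<Phi>\<close> is only of class C1, derivatives along \<open>\<omega>\<close>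
  and v cannot simply be interchanged. Instead the flow equation is integrated in time,
  differentiated under the integral in direction v, and the resulting integral equation is
  differentiated in time.\<close>

lemma variational_equation:
  "((\<lambda>t. D (u + t *\<^sub>R \<omega>) v) has_vector_derivative
     field_diff (\<Phi> (u + t *\<^sub>R \<omega>)) (D (u + t *\<^sub>R \<omega>) v)) (at t)"
proof -
  \<comment> \<open>With this choice t is interior to [-R, R], so the one-sided restriction on the
    derivative can be removed at the end.\<close>
  define R where "R = \<bar>t\<bar> + 1"
  define e where "e \<tau> = field_diff (\<Phi> (u + \<tau> *\<^sub>R \<omega>)) (D (u + \<tau> *\<^sub>R \<omega>) v)" for \<tau>
  have integral_eq: "D (u + s *\<^sub>R \<omega>) v = D (u - R *\<^sub>R \<omega>) v + integral {-R..s} e"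
    if "s \<in> {-R..R}" for s
  proof -
    have flow_eq: "\<Phi> ((u + s *\<^sub>R \<omega>) + x *\<^sub>R v) = \<Phi> ((u - R *\<^sub>R \<omega>) + x *\<^sub>R v) +
        integral (cbox (-R) s) (\<lambda>\<tau>. kovalevskaya_field (\<Phi> ((u + \<tau> *\<^sub>R \<omega>) + x *\<^sub>R v)))" for x
    proof -
      have comm: "(u + \<tau> *\<^sub>R \<omega>) + x *\<^sub>R v = (u + x *\<^sub>R v) + \<tau> *\<^sub>R \<omega>"
          "(u - R *\<^sub>R \<omega>) + x *\<^sub>R v = (u + x *\<^sub>R v) + (- R) *\<^sub>R \<omega>" for \<tau>
        by (simp_all add: algebra_simps)
      have "((\<lambda>\<tau>. kovalevskaya_field (\<Phi> ((u + x *\<^sub>R v) + \<tau> *\<^sub>R \<omega>))) has_integral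
          \<Phi> ((u + x *\<^sub>R v) + s *\<^sub>R \<omega>) - \<Phi> ((u + x *\<^sub>R v) + (- R) *\<^sub>R \<omega>)) {- R..s}"
      proof (rule fundamental_theorem_of_calculus)
        show "- R \<le> s" using that by simp
        show "((\<lambda>\<tau>. \<Phi> ((u + x *\<^sub>R v) + \<tau> *\<^sub>R \<omega>)) has_vector_derivative
            kovalevskaya_field (\<Phi> ((u + x *\<^sub>R v) + \<tau> *\<^sub>R \<omega>))) (at \<tau> within {- R..s})" for \<tau>
          using flow[of "u + x *\<^sub>R v"] unfolding kovalevskaya_solution_def
          by (blast intro: has_vector_derivative_at_within)
      qed
      from integral_unique[OF this] show ?thesis
        unfolding comm cbox_interval by (simp only: add_diff_eq add_diff_cancel_left')
    qed
    have "((\<lambda>x. integral (cbox (-R) s) (\<lambda>\<tau>. kovalevskaya_field (\<Phi> ((u + \<tau> *\<^sub>R \<omega>) + x *\<^sub>R v))))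
        has_vector_derivative integral (cbox (-R) s)
          (\<lambda>\<tau>. field_diff (\<Phi> ((u + \<tau> *\<^sub>R \<omega>) + 0 *\<^sub>R v)) (D ((u + \<tau> *\<^sub>R \<omega>) + 0 *\<^sub>R v) v)))
        (at 0 within UNIV)"
    proof (rule leibniz_rule_vector_derivative)
      show "((\<lambda>x. kovalevskaya_field (\<Phi> (u + \<tau> *\<^sub>R \<omega> + x *\<^sub>R v))) has_vector_derivative
          field_diff (\<Phi> ((u + \<tau> *\<^sub>R \<omega>) + x *\<^sub>R v)) (D ((u + \<tau> *\<^sub>R \<omega>) + x *\<^sub>R v) v))
          (at x within UNIV)" for x \<tau>
        using field_chain[OF line] by simp
      show "(\<lambda>\<tau>. kovalevskaya_field (\<Phi> (u + \<tau> *\<^sub>R \<omega> + x *\<^sub>R v))) integrable_on cbox (- R) s" for x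
        by (intro integrable_continuous continuous_intros
            continuous_on_compose2[OF continuous_kovalevskaya_field[of UNIV]]) auto
      show "continuous_on (UNIV \<times> cbox (- R) s) (\<lambda>(x, \<tau>). field_diff (\<Phi> (u + \<tau> *\<^sub>R \<omega> + x *\<^sub>R v))
          (D (u + \<tau> *\<^sub>R \<omega> + x *\<^sub>R v) v))"
        unfolding case_prod_unfold by (intro continuous_field_diff continuous_intros)
    qed auto
    then have "((\<lambda>x. \<Phi> ((u - R *\<^sub>R \<omega>) + x *\<^sub>R v) +
        integral (cbox (-R) s) (\<lambda>\<tau>. kovalevskaya_field (\<Phi> ((u + \<tau> *\<^sub>R \<omega>) + x *\<^sub>R v))))
        has_vector_derivative D ((u - R *\<^sub>R \<omega>) + 0 *\<^sub>R v) v + integral {-R..s} e) (at 0)"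
      unfolding e_def by (intro has_vector_derivative_add line) simp
    then have "((\<lambda>x. \<Phi> ((u + s *\<^sub>R \<omega>) + x *\<^sub>R v))
        has_vector_derivative D (u - R *\<^sub>R \<omega>) v + integral {-R..s} e) (at 0)"
      unfolding flow_eq by simp
    moreover have "((\<lambda>x. \<Phi> ((u + s *\<^sub>R \<omega>) + x *\<^sub>R v)) has_vector_derivative D (u + s *\<^sub>R \<omega>) v)
        (at 0)"
      using line[of "u + s *\<^sub>R \<omega>" v 0] by simp
    ultimately show ?thesis using vector_derivative_unique_at by blast
  qed
  have "continuous_on {-R..R} e"
    unfolding e_def by (intro continuous_field_diff continuous_intros)
  then have "((\<lambda>s. integral {-R..s} e) has_vector_derivative e t) (at t within {-R..R})"
    by (rule integral_has_vector_derivative) (auto simp: R_def)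
  then have "((\<lambda>s. D (u - R *\<^sub>R \<omega>) v + integral {-R..s} e) has_vector_derivative e t)
      (at t within {-R..R})"
    by (simp add: has_vector_derivative_add_const add.commute[of _ "integral _ _"])
  then have "((\<lambda>s. D (u + s *\<^sub>R \<omega>) v) has_vector_derivative e t) (at t within {-R..R})"
    by (rule has_vector_derivative_transform[rotated 2]) (auto simp: R_def integral_eq)
  moreover have "at t within {-R..R} = at t"
    by (rule at_within_interior) (simp add: R_def abs_if)
  ultimately show ?thesis by (simp only: e_def)
qed

text \<open>The frequency ratio is irrational, so the orbit of the origin meets each vertical circle
  of the torus in a dense set. On that circle the set where f = c is closed.\<close>

lemma constant_if_constant_on_orbit:
  fixes f :: "real \<times> real \<Rightarrow> 'a::t1_space"
  assumes "continuous_on UNIV f"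
    and per: "\<And>a b m n. f (a + 2 * pi * of_int m, b + 2 * pi * of_int n) = f (a, b)"
    and orbit: "\<And>t. f (t *\<^sub>R \<omega>) = c"
  shows "f u = c"
proof -
  obtain a b where u: "u = (a, b)" by fastforce
  define \<theta> where "\<theta> = \<omega>2 / \<omega>1"
  define S where "S = {y. f (a, y) = c}"
  have "continuous_on UNIV (\<lambda>y. f (a, y))"
    by (intro continuous_on_compose2[OF assms(1)] continuous_intros) auto
  then have "closed S"
    unfolding S_def using closed_vimage[OF closed_singleton, of "\<lambda>y. f (a, y)" c]
    by (simp add: vimage_def)
  moreover have "b \<in> closure S"
    unfolding closure_approachable
  proof (intro allI impI)
    fix e :: real assume "e > 0"
    then obtain n m where nm: "\<bar>of_int m * \<theta> - of_int n - (b - a * \<theta>) / (2 * pi)\<bar> < e / (2 * pi)"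
      using sequence_of_fractional_parts_is_dense[of \<theta> "e / (2 * pi)" "(b - a * \<theta>) / (2 * pi)"]
        frequency_ratio unfolding \<theta>_def
      by (metis pi_gt_zero zero_less_divide_iff zero_less_mult_iff zero_less_numeral)
    \<comment> \<open>Up to the period 2 pi n, this is the second coordinate of the orbit at the
      time when the first one equals a + 2 pi m.\<close>
    define y where "y = a * \<theta> + 2 * pi * of_int m * \<theta> - 2 * pi * of_int n"
    have "f (a, y) = f (a + 2 * pi * of_int m, y + 2 * pi * of_int n)"
      by (rule per[symmetric])
    also have "(a + 2 * pi * of_int m, y + 2 * pi * of_int n) =
        ((a + 2 * pi * of_int m) / \<omega>1) *\<^sub>R \<omega>"
      using frequency_nonzero by (simp add: \<omega>_def y_def \<theta>_def field_simps)
    finally have "y \<in> S" by (simp add: S_def orbit)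
    moreover have "y - b = 2 * pi * (of_int m * \<theta> - of_int n - (b - a * \<theta>) / (2 * pi))"
      by (simp add: y_def field_simps)
    then have "dist y b = 2 * pi * \<bar>of_int m * \<theta> - of_int n - (b - a * \<theta>) / (2 * pi)\<bar>"
      by (simp add: dist_real_def abs_mult)
    with nm have "dist y b < e" by (simp add: field_simps)
    ultimately show "\<exists>y\<in>S. dist y b < e" by blast
  qed
  ultimately show ?thesis by (simp add: u S_def)
qed

section \<open>The commuting field in angle coordinates\<close>

lemma D_periodic: "D (a + 2 * pi * of_int m, b + 2 * pi * of_int n) = D (a, b)"
proof -
  define P where "P = (2 * pi * of_int m, 2 * pi * of_int n)"
  have "((\<lambda>x. x + P) has_derivative (\<lambda>x. x)) (at (a, b))"
    by (auto intro!: derivative_eq_intros)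
  from has_derivative_compose[OF this D]
  have "((\<lambda>x. \<Phi> (x + P)) has_derivative D ((a, b) + P)) (at (a, b))" .
  moreover have "(\<lambda>x. \<Phi> (x + P)) = \<Phi>"
    using periodic by (auto simp: P_def fun_eq_iff)
  ultimately have "blinfun_apply (D ((a, b) + P)) = blinfun_apply (D (a, b))"
    using has_derivative_unique D by metis
  then show ?thesis by (simp add: blinfun_apply_inject P_def)
qed

text \<open>The integrals are constant along \<open>\<Phi>\<close>, which gives one inclusion, and
  both spaces have dimension 2. This allows the commuting field to be lifted to the plane of
  angles.\<close>

lemma range_D: "range (D u) = tangent_plane (\<Phi> u)"
proof (rule subspace_dim_equal)
  have lin: "linear (D u)" by (simp add: blinfun.bounded_linear_right bounded_linear.linear)
  show "subspace (range (D u))" using lin by (auto intro: linear_subspace_image)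
  show "subspace (tangent_plane (\<Phi> u))" by (rule subspace_tangent_plane)
  have "dim (range (D u)) = 2"
    using dim_image_eq[OF lin, of UNIV] D_inj by (simp add: dim_UNIV)
  then show "dim (tangent_plane (\<Phi> u)) \<le> dim (range (D u))"
    using dim_tangent_plane[OF in_level_set k] by simp
  show "range (D u) \<subseteq> tangent_plane (\<Phi> u)"
  proof
    fix x assume "x \<in> range (D u)"
    then obtain v where x: "x = D u v" by auto
    have c: "((\<lambda>t. \<Phi> (u + t *\<^sub>R v)) has_vector_derivative x) (at 0)"
      using line[of u v 0] by (simp add: x)
    have "energy (\<Phi> w) = h \<and> area_integral (\<Phi> w) = 0 \<and> geometric_integral (\<Phi> w) = 1 \<and>
        kovalevskaya_integral (\<Phi> w) = k\<^sup>2" for w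
      using in_level_set[of w] by (simp add: level_set_def)
    then show "x \<in> tangent_plane (\<Phi> u)"
      using first_integrals_chain[OF c] DERIV_unique[OF DERIV_const]
      unfolding tangent_plane_def by auto
  qed
qed

text \<open>Along one orbit the commuting field and a constant field of the plane solve the same
  variational equation; by density of the orbit they agree on the torus.\<close>

lemma commuting_field_constant:
  obtains \<eta> where "\<And>u. D u \<eta> = commuting_field (\<Phi> u)"
proof -
  have "commuting_field (\<Phi> 0) \<in> tangent_plane (\<Phi> 0)"
    by (simp add: tangent_plane_def first_integrals_commuting_field)
  then obtain \<eta> where \<eta>: "D 0 \<eta> = commuting_field (\<Phi> 0)"
    using range_D[of 0] by (metis imageE)
  obtain C where C: "\<And>x v. x \<in> range \<Phi> \<Longrightarrow> norm (field_diff x v) \<le> C * norm v"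
    by (rule field_diff_bound[OF compact_imp_bounded[OF compact_range]]) blast
  have orbit: "commuting_field (\<Phi> (t *\<^sub>R \<omega>)) - D (t *\<^sub>R \<omega>) \<eta> = 0" for t
  proof (rule gronwall_zero[where d = "\<lambda>t. commuting_field (\<Phi> (t *\<^sub>R \<omega>)) - D (t *\<^sub>R \<omega>) \<eta>"])
    fix t
    have "((\<lambda>t. commuting_field (\<Phi> (0 + t *\<^sub>R \<omega>)) - D (0 + t *\<^sub>R \<omega>) \<eta>) has_vector_derivative
        field_diff (\<Phi> (0 + t *\<^sub>R \<omega>)) (commuting_field (\<Phi> (0 + t *\<^sub>R \<omega>))) -
        field_diff (\<Phi> (0 + t *\<^sub>R \<omega>)) (D (0 + t *\<^sub>R \<omega>) \<eta>)) (at t)"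
      using flow[of 0] unfolding kovalevskaya_solution_def
      by (intro has_vector_derivative_diff commuting_field_variational variational_equation) blast
    then show "((\<lambda>t. commuting_field (\<Phi> (t *\<^sub>R \<omega>)) - D (t *\<^sub>R \<omega>) \<eta>) has_vector_derivative
        field_diff (\<Phi> (t *\<^sub>R \<omega>)) (commuting_field (\<Phi> (t *\<^sub>R \<omega>)) - D (t *\<^sub>R \<omega>) \<eta>)) (at t)"
      by (simp add: linear_diff[OF field_diff_linear])
    show "norm (field_diff (\<Phi> (t *\<^sub>R \<omega>)) (commuting_field (\<Phi> (t *\<^sub>R \<omega>)) - D (t *\<^sub>R \<omega>) \<eta>))
        \<le> C * norm (commuting_field (\<Phi> (t *\<^sub>R \<omega>)) - D (t *\<^sub>R \<omega>) \<eta>)"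
      by (rule C) simp
  qed (simp add: \<eta>)
  have "commuting_field (\<Phi> u) - D u \<eta> = 0" for u
  proof (rule constant_if_constant_on_orbit[where f = "\<lambda>u. commuting_field (\<Phi> u) - D u \<eta>"])
    show "continuous_on UNIV (\<lambda>u. commuting_field (\<Phi> u) - D u \<eta>)"
      by (intro continuous_intros continuous_on_compose2[OF continuous_commuting_field[of UNIV]]) auto
  qed (simp_all add: periodic D_periodic orbit[simplified])
  then show thesis using that by simp
qed

section \<open>Increments of the precession angle over orbit segments\<close>

definition drift :: "real \<Rightarrow> real \<times> real \<Rightarrow> real" where
  "drift t u = integral {0..t} (\<lambda>s. precession_rate (\<Phi> (u + s *\<^sub>R \<omega>)))"

lemma continuous_rate:
  assumes "continuous_on S f"
  shows "continuous_on S (\<lambda>x. precession_rate (\<Phi> (f x)))"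
  by (rule continuous_on_compose2[OF continuous_precession_rate[OF k(1)]])
    (auto intro!: continuous_intros assms in_level_set)

text \<open>If \<open>H\<close> is the rate of the precession angle along a commuting field \<open>V\<close>, then the derivative of
  the drift along \<open>V\<close> telescopes to the difference of \<open>H\<close> at the ends of the orbit.\<close>

lemma drift_shift:
  assumes v: "\<And>u. D u v = V (\<Phi> u)"
    and V: "continuous_on (level_set h 0 k) V"
    and H: "\<And>u s. ((\<lambda>t. H (\<Phi> (u + t *\<^sub>R \<omega>))) has_real_derivative
        precession_diff (\<Phi> (u + s *\<^sub>R \<omega>)) (V (\<Phi> (u + s *\<^sub>R \<omega>)))) (at s)"
    and M: "\<And>u. \<bar>H (\<Phi> u)\<bar> \<le> M" and t: "t \<ge> 0"
  shows "\<bar>drift t (u + \<beta> *\<^sub>R v) - drift t u\<bar> \<le> 2 * M * \<bar>\<beta>\<bar>"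
proof -
  let ?g = "\<lambda>b s. precession_diff (\<Phi> (u + s *\<^sub>R \<omega> + b *\<^sub>R v)) (V (\<Phi> (u + s *\<^sub>R \<omega> + b *\<^sub>R v)))"
  have comm: "u + s *\<^sub>R \<omega> + b *\<^sub>R v = (u + b *\<^sub>R v) + s *\<^sub>R \<omega>" for s b
    by (simp add: algebra_simps)
  have "((\<lambda>b. drift t (u + b *\<^sub>R v)) has_real_derivative
      H (\<Phi> ((u + b *\<^sub>R v) + t *\<^sub>R \<omega>)) - H (\<Phi> ((u + b *\<^sub>R v) + 0 *\<^sub>R \<omega>))) (at b within UNIV)" for b
  proof -
    have "((\<lambda>b. integral (cbox 0 t) (\<lambda>s. precession_rate (\<Phi> (u + s *\<^sub>R \<omega> + b *\<^sub>R v))))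
        has_real_derivative integral (cbox 0 t) (?g b)) (at b within UNIV)"
    proof (rule leibniz_rule_field_derivative)
      show "((\<lambda>b. precession_rate (\<Phi> (u + s *\<^sub>R \<omega> + b *\<^sub>R v))) has_real_derivative ?g b s)
          (at b within UNIV)" for b s
        using precession_rate_chain[OF line[of "u + s *\<^sub>R \<omega>" v b] in_level_set k(1)]
        unfolding v by simp
      show "(\<lambda>s. precession_rate (\<Phi> (u + s *\<^sub>R \<omega> + b *\<^sub>R v))) integrable_on cbox 0 t" for b
        by (intro integrable_continuous continuous_rate continuous_intros)
      show "continuous_on (UNIV \<times> cbox 0 t) (\<lambda>(b, s). ?g b s)"
        unfolding case_prod_unfold
        by (rule continuous_on_compose2[OF continuous_precession_diff[OF k(1) V]])
          (auto intro!: continuous_intros in_level_set)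
    qed auto
    moreover have "(?g b has_integral
        H (\<Phi> ((u + b *\<^sub>R v) + t *\<^sub>R \<omega>)) - H (\<Phi> ((u + b *\<^sub>R v) + 0 *\<^sub>R \<omega>))) {0..t}"
      unfolding comm
      by (rule fundamental_theorem_of_calculus[OF t])
        (rule has_vector_derivative_at_within
          [OF H[unfolded has_real_derivative_iff_has_vector_derivative]])
    ultimately show ?thesis
      unfolding drift_def comm by (simp add: integral_unique)
  qed
  moreover have "norm (H (\<Phi> ((u + b *\<^sub>R v) + t *\<^sub>R \<omega>)) - H (\<Phi> ((u + b *\<^sub>R v) + 0 *\<^sub>R \<omega>))) \<le> 2 * M" for b
    using M[of "(u + b *\<^sub>R v) + t *\<^sub>R \<omega>"] M[of "(u + b *\<^sub>R v) + 0 *\<^sub>R \<omega>"]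
    unfolding real_norm_def by linarith
  ultimately have "norm (drift t (u + \<beta> *\<^sub>R v) - drift t (u + 0 *\<^sub>R v)) \<le> 2 * M * norm (\<beta> - 0)"
    by (intro field_differentiable_bound[where S = UNIV and f = "\<lambda>b. drift t (u + b *\<^sub>R v)"]) auto
  then show ?thesis by simp
qed

lemma bounded_on_torus:
  assumes "continuous_on (level_set h 0 k) H"
  obtains M :: real where "M \<ge> 0" "\<And>u. \<bar>H (\<Phi> u)\<bar> \<le> M"
proof -
  have "range \<Phi> \<subseteq> level_set h 0 k" using in_level_set by blast
  then have "bounded (H ` range \<Phi>)"
    using continuous_on_subset[OF assms]
    by (intro compact_imp_bounded compact_continuous_image compact_range)
  then obtain M where M: "\<And>u. \<bar>H (\<Phi> u)\<bar> \<le> M" by (auto simp: bounded_iff)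
  then have "M \<ge> 0" using abs_ge_zero[of "H (\<Phi> 0)"] order_trans by blast
  then show thesis using that M by blast
qed

text \<open>Modulo periods, the displacement between two points is a combination of
  \<open>\<omega>\<close> and \<open>\<eta>\<close> with bounded coefficients. Each of the two
  displacements changes the drift by an amount bounded independently of t.\<close>

lemma drift_oscillation:
  obtains C where "\<And>t u u'. t \<ge> 0 \<Longrightarrow> \<bar>drift t u - drift t u'\<bar> \<le> C"
proof -
  obtain \<eta> where \<eta>: "\<And>u. D u \<eta> = commuting_field (\<Phi> u)"
    by (rule commuting_field_constant) blast
  obtain \<eta>1 \<eta>2 where \<eta>_eq: "\<eta> = (\<eta>1, \<eta>2)" by fastforce
  define \<Delta> where "\<Delta> = \<omega>1 * \<eta>2 - \<omega>2 * \<eta>1"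
  \<comment> \<open>A zero determinant would make the two constant fields dependent, and with them
    their images in the phase space.\<close>
  have \<Delta>: "\<Delta> \<noteq> 0"
  proof
    assume "\<Delta> = 0"
    then have "\<eta>1 *\<^sub>R \<omega> + (- \<omega>1) *\<^sub>R \<eta> = 0"
      by (simp add: \<omega>_def \<eta>_eq \<Delta>_def zero_prod_def mult.commute)
    then have "D 0 (\<eta>1 *\<^sub>R \<omega> + (- \<omega>1) *\<^sub>R \<eta>) = 0" by simp
    then have "\<eta>1 *\<^sub>R kovalevskaya_field (\<Phi> 0) + (- \<omega>1) *\<^sub>R commuting_field (\<Phi> 0) = 0"
      by (simp only: blinfun.add_right blinfun.scaleR_right D_frequency \<eta>)
    then show False
      using level_set_fields_independent[OF in_level_set k] frequency_nonzero by fastforce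
  qed
  obtain M1 where M1: "M1 \<ge> 0" "\<And>u. \<bar>precession_rate (\<Phi> u)\<bar> \<le> M1"
    by (rule bounded_on_torus[OF continuous_precession_rate[OF k(1)]]) blast
  obtain M2 where M2: "M2 \<ge> 0" "\<And>u. \<bar>commuting_rate (\<Phi> u)\<bar> \<le> M2"
    by (rule bounded_on_torus[OF continuous_commuting_rate[OF k(1)]]) blast
  have flow': "((\<lambda>t. \<Phi> (u + t *\<^sub>R \<omega>)) has_vector_derivative kovalevskaya_field (\<Phi> (u + s *\<^sub>R \<omega>)))
      (at s)" for u s
    using flow[of u] unfolding kovalevskaya_solution_def by blast
  \<comment> \<open>A bound for the coefficients given by Cramer's rule when both coordinates of the
    displacement lie in [0, 2 pi].\<close>
  define K where "K = 2 * pi * (\<bar>\<omega>1\<bar> + \<bar>\<omega>2\<bar> + \<bar>\<eta>1\<bar> + \<bar>\<eta>2\<bar>) / \<bar>\<Delta>\<bar>"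
  have K: "\<bar>(c * x - d * y) / \<Delta>\<bar> \<le> K"
    if "\<bar>x\<bar> + \<bar>y\<bar> \<le> \<bar>\<omega>1\<bar> + \<bar>\<omega>2\<bar> + \<bar>\<eta>1\<bar> + \<bar>\<eta>2\<bar>" "\<bar>c\<bar> \<le> 2 * pi" "\<bar>d\<bar> \<le> 2 * pi" for c d x y
  proof -
    have "\<bar>c * x - d * y\<bar> \<le> \<bar>c\<bar> * \<bar>x\<bar> + \<bar>d\<bar> * \<bar>y\<bar>"
      using abs_triangle_ineq4[of "c * x" "d * y"] by (simp add: abs_mult)
    also have "\<dots> \<le> 2 * pi * \<bar>x\<bar> + 2 * pi * \<bar>y\<bar>"
      using that by (intro add_mono mult_right_mono) auto
    also have "\<dots> = 2 * pi * (\<bar>x\<bar> + \<bar>y\<bar>)" by (simp add: algebra_simps)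
    also have "\<dots> \<le> 2 * pi * (\<bar>\<omega>1\<bar> + \<bar>\<omega>2\<bar> + \<bar>\<eta>1\<bar> + \<bar>\<eta>2\<bar>)"
      using that by (intro mult_left_mono) auto
    finally show ?thesis unfolding K_def abs_divide by (rule divide_right_mono) simp
  qed
  show thesis
  proof (rule that)
    fix t :: real and u u' :: "real \<times> real" assume t: "t \<ge> 0"
    obtain w where w: "w \<in> cbox (0, 0) (2 * pi, 2 * pi)" "\<And>v. \<Phi> (u - u' + v) = \<Phi> (w + v)"
      by (rule reduce_mod_periods[of "u - u'"]) blast
    obtain c d where cd: "w = (c, d)" by fastforce
    \<comment> \<open>Cramer's rule for w = \<alpha> \<omega> + \<beta> \<eta>.\<close>
    define \<alpha> \<beta> where "\<alpha> = (c * \<eta>2 - d * \<eta>1) / \<Delta>" and "\<beta> = (d * \<omega>1 - c * \<omega>2) / \<Delta>"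
    have "c = \<alpha> * \<omega>1 + \<beta> * \<eta>1"
    proof -
      have "\<Delta> * c = \<Delta> * (\<alpha> * \<omega>1 + \<beta> * \<eta>1)" using \<Delta> unfolding \<alpha>_def \<beta>_def
        by (simp add: distrib_left) (simp add: \<Delta>_def algebra_simps)
      then show ?thesis using \<Delta> by simp
    qed
    moreover have "d = \<alpha> * \<omega>2 + \<beta> * \<eta>2"
    proof -
      have "\<Delta> * d = \<Delta> * (\<alpha> * \<omega>2 + \<beta> * \<eta>2)" using \<Delta> unfolding \<alpha>_def \<beta>_def
        by (simp add: distrib_left) (simp add: \<Delta>_def algebra_simps)
      then show ?thesis using \<Delta> by simp
    qed
    ultimately have w_eq: "w = \<alpha> *\<^sub>R \<omega> + \<beta> *\<^sub>R \<eta>" by (simp add: cd \<omega>_def \<eta>_eq)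
    have "\<Phi> (u + s *\<^sub>R \<omega>) = \<Phi> (u' + \<alpha> *\<^sub>R \<omega> + \<beta> *\<^sub>R \<eta> + s *\<^sub>R \<omega>)" for s
      using w(2)[of "u' + s *\<^sub>R \<omega>"] by (simp add: w_eq algebra_simps)
    then have "drift t u = drift t (u' + \<alpha> *\<^sub>R \<omega> + \<beta> *\<^sub>R \<eta>)"
      by (simp add: drift_def)
    moreover have "\<bar>drift t (u' + \<alpha> *\<^sub>R \<omega> + \<beta> *\<^sub>R \<eta>) - drift t (u' + \<alpha> *\<^sub>R \<omega>)\<bar> \<le> 2 * M2 * \<bar>\<beta>\<bar>"
      by (rule drift_shift[where V = commuting_field and H = commuting_rate,
            OF \<eta> continuous_commuting_field
            commuting_rate_along_field[OF flow' in_level_set k(1)] M2(2) t])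
    \<comment> \<open>Along the flow itself the rate of the angle is the precession rate, so the
      same estimate applies with V = X and H = F.\<close>
    moreover have "\<bar>drift t (u' + \<alpha> *\<^sub>R \<omega>) - drift t u'\<bar> \<le> 2 * M1 * \<bar>\<alpha>\<bar>"
      by (rule drift_shift[where V = kovalevskaya_field and H = precession_rate,
            OF D_frequency continuous_kovalevskaya_field
            precession_rate_chain[OF flow' in_level_set k(1)] M1(2) t])
    moreover have "\<bar>c\<bar> \<le> 2 * pi" "\<bar>d\<bar> \<le> 2 * pi"
      using w(1) by (simp_all add: cd cbox_Pair_iff)
    then have "\<bar>\<alpha>\<bar> \<le> K" "\<bar>\<beta>\<bar> \<le> K"
      unfolding \<alpha>_def \<beta>_def by (rule_tac [!] K) simp_all
    then have "2 * M2 * \<bar>\<beta>\<bar> \<le> 2 * M2 * K" "2 * M1 * \<bar>\<alpha>\<bar> \<le> 2 * M1 * K"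
      using M1 M2 by (auto intro!: mult_left_mono)
    ultimately show "\<bar>drift t u - drift t u'\<bar> \<le> 2 * M2 * K + 2 * M1 * K" by linarith
  qed
qed

text \<open>A maximum point of \<open>q\<^sup>2\<close> is a zero of the derivatives of \<open>q\<close> along both fields.\<close>

lemma reversal_fixed_point:
  obtains u where "reversal (\<Phi> u) = \<Phi> u"
proof -
  have "continuous_on (range \<Phi>) (\<lambda>x. (fst (snd x))\<^sup>2)" by (intro continuous_intros)
  from continuous_attains_sup[OF compact_range _ this]
  obtain u where u: "\<And>w. (fst (snd (\<Phi> w)))\<^sup>2 \<le> (fst (snd (\<Phi> u)))\<^sup>2" by auto
  have crit: "fst (snd (D u v)) = 0" for v
  proof -
    let ?f = "\<lambda>s. fst (snd (\<Phi> (u + s *\<^sub>R v)))"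
    have d: "(?f has_real_derivative fst (snd (D u v))) (at 0)"
      using bounded_linear.has_vector_derivative[OF bounded_linear_fst
          bounded_linear.has_vector_derivative[OF bounded_linear_snd line[of u v 0]]]
      by (simp add: has_real_derivative_iff_has_vector_derivative)
    show ?thesis
    proof (cases "fst (snd (\<Phi> u)) = 0")
      \<comment> \<open>If the maximum of the square of q is 0, then q vanishes on the whole torus;
        otherwise dividing by q turns a critical point of its square into one of q.\<close>
      case True
      then have "?f = (\<lambda>s. 0)" using u by (simp add: fun_eq_iff)
      then show ?thesis using d DERIV_unique[OF DERIV_const] by metis
    next
      case False
      have "((\<lambda>s. (?f s)\<^sup>2) has_real_derivative 2 * ?f 0 * fst (snd (D u v))) (at 0)"
        by (rule derivative_eq_intros d refl | simp)+
      then have "2 * ?f 0 * fst (snd (D u v)) = 0"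
        by (rule DERIV_local_max[OF _ zero_less_one]) (use u in auto)
      then show ?thesis using False by simp
    qed
  qed
  obtain \<eta> where \<eta>: "\<And>u. D u \<eta> = commuting_field (\<Phi> u)"
    by (rule commuting_field_constant) blast
  obtain p q r g1 g2 g3 where x: "\<Phi> u = (p, q, r, g1, g2, g3)"
    by (metis prod.exhaust)
  have "p = 0 \<and> g2 = 0 \<and> g3 = 0"
    using level_set_q_critical[OF in_level_set[of u, unfolded x] k(1,2) h_pos]
      crit[of \<omega>] crit[of \<eta>] unfolding D_frequency \<eta> x by blast
  then have "reversal (\<Phi> u) = \<Phi> u" by (simp add: x)
  then show thesis by (rule that)
qed

lemma drift_bounded:
  obtains C where "\<And>t u. t \<ge> 0 \<Longrightarrow> \<bar>drift t u\<bar> \<le> C"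
proof -
  obtain C where C: "\<And>t u u'. t \<ge> 0 \<Longrightarrow> \<bar>drift t u - drift t u'\<bar> \<le> C"
    by (rule drift_oscillation) blast
  obtain u where u: "reversal (\<Phi> u) = \<Phi> u"
    by (rule reversal_fixed_point) blast
  have bdd: "bounded (range (\<lambda>t. \<Phi> (u + t *\<^sub>R \<omega>)))"
    by (rule bounded_subset[OF compact_imp_bounded[OF compact_range]]) auto
  \<comment> \<open>Both sides are bounded solutions with the same value at time 0, since
    \<open>\<Phi> u\<close> is fixed by the reversal.\<close>
  have rev: "reversal (\<Phi> (u + (- t) *\<^sub>R \<omega>)) = \<Phi> (u + t *\<^sub>R \<omega>)" for t
  proof (rule kovalevskaya_solution_unique[OF kovalevskaya_solution_reversal[OF flow] _ flow bdd])
    have "range (\<lambda>t. reversal (\<Phi> (u + (- t) *\<^sub>R \<omega>))) \<subseteq> reversal ` range \<Phi>" by auto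
    moreover have "bounded (reversal ` range \<Phi>)"
      using linear_conv_bounded_linear linear_reversal
      by (intro bounded_linear_image compact_imp_bounded compact_range) blast
    ultimately show "bounded (range (\<lambda>t. reversal (\<Phi> (u + (- t) *\<^sub>R \<omega>))))"
      by (rule bounded_subset[rotated])
  qed (simp add: u)
  have "\<bar>drift t w\<bar> \<le> 2 * C" if t: "t \<ge> 0" for t w
  proof -
    let ?g = "\<lambda>s. precession_rate (\<Phi> (u + s *\<^sub>R \<omega>))"
    \<comment> \<open>The segment of length t ending at the fixed point is shifted to [-t, 0] and
      reflected to [0, t], where the symmetry changes the sign of the rate.\<close>
    have "integral {0..t} ((\<lambda>s. ?g (s - t))) = integral {- t..0} ?g"
      using integral_shift_Icc_real[of 0 t ?g "- t"] by (simp add: o_def add.commute)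
    also have "\<dots> = integral {0..t} (\<lambda>s. ?g (- s))"
      using Henstock_Kurzweil_Integration.integral_reflect_real
        [where a = 0 and b = t and f = "\<lambda>s. ?g (- s)"] by simp
    also have "(\<lambda>s. ?g (- s)) = (\<lambda>s. - ?g s)"
      using rev precession_rate_reversal by (metis minus_minus)
    finally have "drift t (u - t *\<^sub>R \<omega>) = - drift t u"
      unfolding drift_def by (simp add: algebra_simps scaleR_diff_left)
    \<comment> \<open>The two drifts are opposite, so their difference is twice the drift at u in
      absolute value. A second use of the oscillation bound passes from u to any w.\<close>
    then have "\<bar>drift t u\<bar> * 2 \<le> C" using C[OF t, of "u - t *\<^sub>R \<omega>" u] by linarith
    then show ?thesis using C[OF t, of w u] by linarith
  qed
  then show thesis by (rule that)
qed

section \<open>Boundedness of the precession angle\<close>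

lemma precession_angle_bounded:
  assumes "kovalevskaya_solution x" and "\<And>t. x t \<in> level_set h 0 k" and "x 0 \<in> range \<Phi>"
    and \<psi>: "precession_angle x \<psi>"
  shows "bounded (range \<psi>)"
proof -
  obtain u where u: "x 0 = \<Phi> u" using assms(3) by auto
  have x: "x t = \<Phi> (u + t *\<^sub>R \<omega>)" for t
  proof (rule kovalevskaya_solution_unique[OF assms(1) _ flow])
    show "bounded (range x)"
      by (rule bounded_subset[OF bounded_level_set]) (use assms(2) in auto)
    show "bounded (range (\<lambda>t. \<Phi> (u + t *\<^sub>R \<omega>)))"
      by (rule bounded_subset[OF compact_imp_bounded[OF compact_range]]) auto
  qed (simp add: u)
  obtain C where C: "\<And>t u. t \<ge> 0 \<Longrightarrow> \<bar>drift t u\<bar> \<le> C"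
    by (rule drift_bounded) blast
  \<comment> \<open>The starting time s is arbitrary so that negative times are covered too: for t <
    0 the increment over [t, 0] starts at s = t.\<close>
  have incr: "\<bar>\<psi> (s + t) - \<psi> s\<bar> \<le> C" if t: "t \<ge> 0" for s t
  proof -
    have "((\<lambda>\<tau>. precession_rate (\<Phi> ((u + s *\<^sub>R \<omega>) + \<tau> *\<^sub>R \<omega>))) has_integral \<psi> (s + t) - \<psi> (s + 0))
        {0..t}"
    proof (rule fundamental_theorem_of_calculus[OF t])
      fix \<tau>
      have "((\<lambda>\<tau>. \<psi> (s + \<tau>)) has_real_derivative precession_rate (x (s + \<tau>))) (at \<tau>)"
        using \<psi>[unfolded precession_angle_def, rule_format, of "s + \<tau>"] DERIV_shift[of \<psi> _ \<tau> s]
        by (simp add: add.commute)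
      moreover have "x (s + \<tau>) = \<Phi> ((u + s *\<^sub>R \<omega>) + \<tau> *\<^sub>R \<omega>)"
        by (simp add: x scaleR_add_left add.assoc)
      ultimately show "((\<lambda>\<tau>. \<psi> (s + \<tau>)) has_vector_derivative
          precession_rate (\<Phi> ((u + s *\<^sub>R \<omega>) + \<tau> *\<^sub>R \<omega>))) (at \<tau> within {0..t})"
        by (simp only: has_real_derivative_iff_has_vector_derivative has_vector_derivative_at_within)
    qed
    then have "drift t (u + s *\<^sub>R \<omega>) = \<psi> (s + t) - \<psi> s"
      unfolding drift_def by (simp add: integral_unique)
    then show ?thesis using C[OF t, of "u + s *\<^sub>R \<omega>"] by simp
  qed
  show ?thesis
  proof (rule boundedI)
    fix y assume "y \<in> range \<psi>"
    then obtain t where y: "y = \<psi> t" by auto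
    have "\<bar>\<psi> t - \<psi> 0\<bar> \<le> C"
      using incr[of t 0] incr[of "- t" t] by (cases "t \<ge> 0") (auto simp: abs_minus_commute)
    then show "norm y \<le> \<bar>\<psi> 0\<bar> + C" unfolding y real_norm_def by linarith
  qed
qed

end

theorem proposition3:
  fixes x :: "real \<Rightarrow> phase" and \<psi> :: "real \<Rightarrow> real" and h k :: real
  assumes "kovalevskaya_solution x"
    and "\<And>t. x t \<in> level_set h 0 k"
    and "(k\<^sup>2, h) \<in> {(K, h). h > 0 \<and> 0 < K \<and> K < h\<^sup>2 \<and> K < 1} \<or>
         (k\<^sup>2, h) \<in> {(K, h). h > 0 \<and> 1 < K \<and> K < h\<^sup>2}"
    and "nonresonant_torus (connected_component_set (level_set h 0 k) (x 0))"
    and "precession_angle x \<psi>"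
  shows "has_mean_motion \<psi> 0"
proof -
  obtain \<Phi> \<omega>1 \<omega>2 where \<Phi>: "angle_coordinates (connected_component_set (level_set h 0 k) (x 0)) \<Phi>"
    "linear_flow \<Phi> \<omega>1 \<omega>2" "rationally_independent \<omega>1 \<omega>2"
    using assms(4) unfolding nonresonant_torus_def by blast
  then obtain D where D: "continuous_on UNIV D"
    "\<And>u. (\<Phi> has_derivative blinfun_apply (D u)) (at u)" "\<And>u. inj (blinfun_apply (D u))"
    unfolding angle_coordinates_def by blast
  have range: "range \<Phi> = connected_component_set (level_set h 0 k) (x 0)"
    using \<Phi>(1) unfolding angle_coordinates_def by blast
  have per: "\<Phi> (a + 2 * pi * of_int m, b + 2 * pi * of_int n) = \<Phi> (a, b)" for a b m n
    using \<Phi>(1) unfolding angle_coordinates_def by metis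
  interpret kovalevskaya_torus h k \<omega>1 \<omega>2 \<Phi> D
  proof
    show "\<Phi> u \<in> level_set h 0 k" for u
      using range connected_component_subset by blast
  qed (use assms(3) \<Phi> D per in auto)
  have "x 0 \<in> range \<Phi>"
    unfolding range using assms(2) by (simp add: connected_component_refl)
  from precession_angle_bounded[OF assms(1,2) this assms(5)]
  show ?thesis by (simp add: has_mean_motion_def)
qed

end
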